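(* Let $d\in\mathbb{N}$, $\beta>d$, and let $\mu$ be a probability density on $\mathbb{R}^d$ and $f^*:\mathbb{R}^d\to\{\pm1\}$ a target function satisfying the regularity assumption below. Then for every noise level $p\in(0,0.49)$, \[ C_1(\beta/d)\cdot p^{c(\beta/d)}~\leq~\mathcal{L}(\hat{h}_\beta)~\leq~C_2(\beta/d)\cdot\log^{\frac{1}{1-d/\beta}}(1/p)\cdot p, \] where $c(\beta/d)=\left(\frac{8\cdot 2^{\beta/d}}{\beta/d-1}\right)^{\frac{1}{\beta/d-1}}>0$ and $C_1(\beta/d),C_2(\beta/d)>0$ are constants depending only on the ratio $\beta/d$.
   Context: Training data $S=(\mathbf{x}_i,y_i)_{i=1}^m\subset\mathbb{R}^d\times\{\pm1\}$: the $\mathbf{x}_i$ are i.i.d. from the distribution $\mathcal{D}_\mathbf{x}$ with density $\mu$, and independently for each $i$, $y_i=f^*(\mathbf{x}_i)$ with probability $1-p$ and $y_i=-f^*(\mathbf{x}_i)$ with probability $p$. The Nadaraya–Watson interpolator is $\hat{h}_\beta(\mathbf{x})=\mathrm{sign}\big(\sum_{i=1}^m y_i\|\mathbf{x}-\mathbf{x}_i\|^{-\beta}\big)$ if $\mathbf{x}\notin\{\mathbf{x}_1,\dots,\mathbf{x}_m\}$, and $\hat{h}_\beta(\mathbf{x}_i)=y_i$. The asymptotic clean classification error is $\mathcal{L}(\hat{h}_\beta)=\lim_{m\to\infty}\mathbb{E}_S\big[\Pr_{\mathbf{x}\sim\mathcal{D}_\mathbf{x}}[\hat{h}_\beta(\mathbf{x})\neq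 f^*(\mathbf{x})]\big]$; if the limit does not exist, the lower bound is to be read for the $\liminf$ and the upper bound for the $\limsup$. Regularity assumption: $\mu$ is continuous at Lebesgue-almost every $\mathbf{x}\in\mathbb{R}^d$, and for Lebesgue-almost every $\mathbf{x}\in\mathbb{R}^d$ there is a neighborhood $B_\mathbf{x}\ni\mathbf{x}$ on which $f^*$ is constant (equal to $f^*(\mathbf{x})$). *)

theory Defs
  imports "HOL-Probability.Probability"
begin

text \<open>Points of R^d are represented as functions nat => real, extensional on {..<d}
  (the carrier of the product measure PiM {..<d} (%_. lborel)).  This explicit
  representation is needed because the constants may depend only on beta/d, so the
  dimension d must be quantified inside the statement.\<close>

definition dist_d :: "nat \<Rightarrow> (nat \<Rightarrow> real) \<Rightarrow> (nat \<Rightarrow> real) \<Rightarrow> real" where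
  "dist_d d x y = sqrt (\<Sum>i<d. (x i - y i)^2)"

definition Leb_d :: "nat \<Rightarrow> (nat \<Rightarrow> real) measure" where
  "Leb_d d = completion (PiM {..<d} (\<lambda>_. lborel))"

definition cont_at_d :: "nat \<Rightarrow> ((nat \<Rightarrow> real) \<Rightarrow> real) \<Rightarrow> (nat \<Rightarrow> real) \<Rightarrow> bool" where
  "cont_at_d d g x = (\<forall>\<epsilon>>0. \<exists>\<delta>>0. \<forall>y\<in>space (Leb_d d). dist_d d x y < \<delta> \<longrightarrow> \<bar>g y - g x\<bar> < \<epsilon>)"

definition locally_const_at_d :: "nat \<Rightarrow> ((nat \<Rightarrow> real) \<Rightarrow> real) \<Rightarrow> (nat \<Rightarrow> real) \<Rightarrow> bool" where
  "locally_const_at_d d f x = (\<exists>r>0. \<forall>y\<in>space (Leb_d d). dist_d d x y < r \<longrightarrow> f y = f x)"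

definition prob_density_d :: "nat \<Rightarrow> ((nat \<Rightarrow> real) \<Rightarrow> real) \<Rightarrow> bool" where
  "prob_density_d d \<mu> = (\<mu> \<in> borel_measurable (Leb_d d) \<and> (\<forall>x\<in>space (Leb_d d). 0 \<le> \<mu> x)
      \<and> (\<integral>\<^sup>+ x. ennreal (\<mu> x) \<partial>Leb_d d) = 1)"

definition NW_interp :: "nat \<Rightarrow> real \<Rightarrow> nat \<Rightarrow> (nat \<Rightarrow> nat \<Rightarrow> real) \<Rightarrow> (nat \<Rightarrow> real)
    \<Rightarrow> (nat \<Rightarrow> real) \<Rightarrow> real" where
  "NW_interp d \<beta> m xs ys x =
     (if \<exists>i<m. xs i = x then ys (LEAST i. i < m \<and> xs i = x)
      else sgn (\<Sum>i<m. ys i * dist_d d x (xs i) powr (- \<beta>)))"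

text \<open>Expected clean error for sample size m: points zs 0..zs (m-1) are the training
  inputs and zs m is the fresh test point, all i.i.d. with density mu; F is the set of
  indices whose label is flipped, each independently with probability p.\<close>
definition exp_clean_error :: "nat \<Rightarrow> real \<Rightarrow> ((nat \<Rightarrow> real) \<Rightarrow> real) \<Rightarrow> ((nat \<Rightarrow> real) \<Rightarrow> real)
    \<Rightarrow> real \<Rightarrow> nat \<Rightarrow> ennreal" where
  "exp_clean_error d \<beta> \<mu> f p m =
     (\<integral>\<^sup>+ zs. (\<Sum>F\<in>Pow {..<m}. ennreal (p ^ card F * (1 - p) ^ (m - card F)) *
          (if NW_interp d \<beta> m zs (\<lambda>i. if i \<in> F then - f (zs i) else f (zs i)) (zs m) \<noteq> f (zs m)
           then 1 else 0))
      \<partial>completion (PiM {..m} (\<lambda>_. density (Leb_d d) (\<lambda>x. ennreal (\<mu> x)))))"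

definition c_exp :: "real \<Rightarrow> real" where
  "c_exp r = (8 * 2 powr r / (r - 1)) powr (1 / (r - 1))"

end

theory Submission
  imports Defs
begin

text \<open>
  Put $r = \beta/d$. At almost every test point $x$ with $\mu(x) > 0$, rescaling distances to
  $T(z) = V_d\,\mu(x)\,\|x - z\|^d$ (with $V_d$ the volume of the unit ball) turns the weights into
  multiples of $T^{-r}$, and near $0$ the distribution function of $T$ lies between $u/2$ and $2u$;
  after this the dimension has disappeared.

  Upper bound: with $a = 2 \ln(1/p)$ and $b$ of order $a^{r/(r-1)}$, outside events of probability
  $p$, $2pb$ and $p$ some sample has $T \le a/m$, no sample with $T \le b/m$ is flipped, and
  (Chernoff) all samples with $T > b/m$ together weigh less than $(a/m)^{-r}$; the vote is then
  correct. Lower bound: with probability bounded below in terms of $r$ alone there is a single sample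
  with $T \le 1/(8m)$, close enough to $x$ to outweigh all the others, and it is flipped with
  probability $p$; so the error is at least a multiple of $p \ge p^{c(r)}$, as $c(r) \ge 1$.
  The bounds at fixed $x$ are integrated by Fatou's lemma. The error is squeezed between measurable
  functions, so the measurability of the interpolator itself never enters.
\<close>

subsection \<open>Lebesgue measure on the explicit product space\<close>

text \<open>The constants may depend on \<open>r\<close> only, but the range \<open>u0\<close> on
  which the distribution of T is controlled depends on x and \<mu>. Each estimate therefore
  separates the weight of samples with T > \<open>u0\<close>; after scaling it carries a factor
  m^(1-r), which tends to 0, so \<open>u0\<close> only decides how large m must be. The logarithmic
  exponent comes from balancing the radii s = a/m and t = b/m. A sample beyond t has mean weight of
  order t^(1-r), so the far samples together weigh about m t^(1-r) = m^r b^(1-r). This must be a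
  small fraction of the weight s^(-r) = m^r a^(-r) of one near sample, which gives b of order
  a^(r/(r-1)), and r/(r-1) = 1/(1 - d/\<beta>). With this balance a first moment bounds the failure
  probability only by a constant. The upper bound needs it down to p, hence an exponential moment
  with a proportional to ln(1/p); cutting the weights off at t keeps them bounded and makes that
  moment usable. For the lower bound a constant fraction is enough, so first moments suffice
  there.\<close>

lemma space_Leb_d: "space (Leb_d d) = extensional {..<d}"
  by (simp add: Leb_d_def space_PiM PiE_def)

lemma measurable_component_Leb_d:
  assumes "i < d"
  shows "(\<lambda>x. x i) \<in> borel_measurable (Leb_d d)"
proof -
  have "(\<lambda>x. x i) \<in> measurable (PiM {..<d} (\<lambda>_. lborel :: real measure)) lborel"
    using assms by (intro measurable_component_singleton) auto
  then show ?thesis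
    unfolding Leb_d_def by (intro measurable_completion) simp
qed

lemma measurable_dist_d [measurable]:
  assumes [measurable]: "g \<in> measurable N (Leb_d d)" "h \<in> measurable N (Leb_d d)"
  shows "(\<lambda>w. dist_d d (g w) (h w)) \<in> borel_measurable N"
proof -
  have "(\<lambda>w. g w i) \<in> borel_measurable N" "(\<lambda>w. h w i) \<in> borel_measurable N" if "i < d" for i
    using measurable_compose[OF assms(1) measurable_component_Leb_d[OF that]]
      measurable_compose[OF assms(2) measurable_component_Leb_d[OF that]] by auto
  then show ?thesis
    unfolding dist_d_def
    by (intro measurable_compose[OF _ borel_measurable_sqrt] borel_measurable_sum
        borel_measurable_power borel_measurable_diff) auto
qed

lemma dist_d_nonneg: "dist_d d x y \<ge> 0"
  by (simp add: dist_d_def sum_nonneg)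

lemma dist_d_self [simp]: "dist_d d x x = 0"
  by (simp add: dist_d_def)

text \<open>Moves balls around an arbitrary point to the origin. A product measure is determined by
  its values on boxes, and on a box the claim is translation invariance of \<open>lborel\<close> in
  each coordinate.\<close>

lemma distr_PiM_lborel_shift:
  fixes c :: "nat \<Rightarrow> real"
  shows "distr (PiM {..<d} (\<lambda>_. lborel)) (PiM {..<d} (\<lambda>_. lborel)) (\<lambda>y. \<lambda>i\<in>{..<d}. y i - c i)
    = PiM {..<d} (\<lambda>_. lborel)"
    (is "distr ?P ?P ?g = ?P")
proof -
  interpret product_sigma_finite "\<lambda>_::nat. lborel :: real measure"
    by standard
  have [measurable]: "?g \<in> measurable ?P ?P"
    by measurable
  show ?thesis
  proof (rule PiM_eqI)
    fix A :: "nat \<Rightarrow> real set"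
    assume "\<And>i. i \<in> {..<d} \<Longrightarrow> A i \<in> sets lborel"
    then have A [measurable]: "A i \<in> sets borel" if "i < d" for i
      using that by simp
    have eq: "emeasure lborel ((\<lambda>t. t - c i) -` A i \<inter> space lborel) = emeasure lborel (A i)"
      if "i < d" for i
    proof -
      have "emeasure lborel (A i) = emeasure (distr lborel borel (\<lambda>t. t - c i)) (A i)"
        using lborel_affine[of 1 "- c i"] by (simp add: density_1 add.commute)
      also have "\<dots> = emeasure lborel ((\<lambda>t. t - c i) -` A i \<inter> space lborel)"
        using A[OF that] by (subst emeasure_distr) auto
      finally show ?thesis by simp
    qed
    have *: "?g -` (Pi\<^sub>E {..<d} A) \<inter> space ?P
        = Pi\<^sub>E {..<d} (\<lambda>i. (\<lambda>t. t - c i) -` A i \<inter> space lborel)"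
      by (auto simp: space_PiM PiE_iff)
    have "emeasure (distr ?P ?P ?g) (Pi\<^sub>E {..<d} A) = emeasure ?P (?g -` (Pi\<^sub>E {..<d} A) \<inter> space ?P)"
      using A by (intro emeasure_distr sets_PiM_I_finite) auto
    also have "\<dots> = (\<Prod>i<d. emeasure lborel ((\<lambda>t. t - c i) -` A i \<inter> space lborel))"
      unfolding * by (subst emeasure_PiM) (auto intro!: measurable_sets_borel[of _ borel] A)
    also have "\<dots> = (\<Prod>i<d. emeasure lborel (A i))"
      by (intro prod.cong eq) auto
    finally show "emeasure (distr ?P ?P ?g) (Pi\<^sub>E {..<d} A) = (\<Prod>i<d. emeasure lborel (A i))" .
  qed auto
qed

lemma emeasure_Leb_d_cball:
  assumes "\<rho> > 0"
  shows "emeasure (Leb_d d) {y \<in> space (Leb_d d). dist_d d x y \<le> \<rho>}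
    = ennreal (unit_ball_vol (real d) * \<rho> ^ d)"
proof -
  let ?P = "PiM {..<d} (\<lambda>_. lborel :: real measure)"
  let ?g = "\<lambda>y. \<lambda>i\<in>{..<d}. y i - x i"
  let ?B = "{f. sqrt (\<Sum>i<d. (f i)\<^sup>2) \<le> \<rho>} \<inter> space ?P"
  have B: "?B \<in> sets ?P"
  proof -
    have "(\<lambda>f. sqrt (\<Sum>i<d. (f i)\<^sup>2)) \<in> borel_measurable ?P"
      by measurable
    then have "{f \<in> space ?P. sqrt (\<Sum>i<d. (f i)\<^sup>2) \<le> \<rho>} \<in> sets ?P"
      by simp
    moreover have "{f \<in> space ?P. sqrt (\<Sum>i<d. (f i)\<^sup>2) \<le> \<rho>} = ?B"
      by blast
    ultimately show ?thesis by simp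
  qed
  have "(\<Sum>i<d. (?g y i)\<^sup>2) = (\<Sum>i<d. (x i - y i)\<^sup>2)" for y
    by (intro sum.cong) (simp_all add: power2_commute)
  then have eq: "{y \<in> space (Leb_d d). dist_d d x y \<le> \<rho>} = ?g -` ?B \<inter> space ?P"
    by (auto simp: Leb_d_def dist_d_def space_PiM)
  have m: "?g \<in> measurable ?P ?P" by measurable
  have "emeasure (Leb_d d) {y \<in> space (Leb_d d). dist_d d x y \<le> \<rho>} = emeasure ?P (?g -` ?B \<inter> space ?P)"
    unfolding eq unfolding Leb_d_def
    using measurable_sets[OF m B] by simp
  also have "\<dots> = emeasure (distr ?P ?P ?g) ?B"
    by (rule emeasure_distr[symmetric]) (use m B in simp_all)
  also have "\<dots> = emeasure ?P ?B"
    by (simp only: distr_PiM_lborel_shift)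
  also have "\<dots> = ennreal (unit_ball_vol (real d) * \<rho> ^ d)"
    using emeasure_cball_aux[of "{..<d}" \<rho>] assms by simp
  finally show ?thesis .
qed

text \<open>The balls that make up \<open>U\<close> form an uncountable union, so measurability has
  to come from topology. Each ball is the trace of an open set of the product topology on all
  functions, the union \<open>W\<close> of these is open and thus Borel, and \<open>U\<close> is its
  preimage under the map \<open>e\<close> that pads a point with zeros beyond coordinate d.\<close>

lemma sets_Leb_d_dist_open:
  assumes "U \<subseteq> space (Leb_d d)"
    and "\<And>x. x \<in> U \<Longrightarrow> \<exists>\<rho>>0. \<forall>y\<in>space (Leb_d d). dist_d d x y < \<rho> \<longrightarrow> y \<in> U"
  shows "U \<in> sets (Leb_d d)"
proof -
  obtain \<rho> where \<rho>: "\<And>x. x \<in> U \<Longrightarrow> \<rho> x > 0"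
    "\<And>x y. x \<in> U \<Longrightarrow> y \<in> space (Leb_d d) \<Longrightarrow> dist_d d x y < \<rho> x \<Longrightarrow> y \<in> U"
    using assms(2) by metis
  define W :: "(nat \<Rightarrow> real) set" where "W = (\<Union>x\<in>U. {y. dist_d d x y < \<rho> x})"
  have "open W"
    unfolding W_def dist_d_def
    by (intro open_UN ballI open_Collect_less continuous_intros continuous_on_product_coordinates)
  then have W: "W \<in> sets borel" by simp
  define e :: "(nat \<Rightarrow> real) \<Rightarrow> nat \<Rightarrow> real" where "e = (\<lambda>x i. if i < d then x i else 0)"
  have e: "e \<in> borel_measurable (Leb_d d)"
  proof (rule measurable_coordinatewise_then_product)
    show "(\<lambda>x. e x i) \<in> borel_measurable (Leb_d d)" for i
      by (cases "i < d") (simp_all add: e_def measurable_component_Leb_d)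
  qed
  have "dist_d d x (e y) = dist_d d x y" for x y
    by (simp add: dist_d_def e_def)
  then have eW: "e y \<in> W \<longleftrightarrow> (\<exists>x\<in>U. dist_d d x y < \<rho> x)" for y
    by (simp add: W_def)
  have "e -` W \<inter> space (Leb_d d) = U"
  proof (intro equalityI subsetI)
    fix y assume "y \<in> U"
    then show "y \<in> e -` W \<inter> space (Leb_d d)"
      using \<rho>(1)[of y] assms(1) eW[of y] by (auto intro: bexI[of _ y])
  qed (use \<rho>(2) eW in auto)
  then show ?thesis
    using measurable_sets[OF e W] by simp
qed

text \<open>Measurability of the target function is derived from its regularity. The interior
  \<open>U\<close> of the level set for the value 1 is open, local constancy makes it agree with
  that level set almost everywhere, and completeness of \<open>Leb_d\<close> transfers
  measurability.\<close>

lemma measurable_locally_const: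
  fixes f :: "(nat \<Rightarrow> real) \<Rightarrow> real"
  assumes f: "\<forall>x\<in>space (Leb_d d). f x \<in> {-1, 1}"
    and lc: "AE x in Leb_d d. locally_const_at_d d f x"
  shows "f \<in> borel_measurable (Leb_d d)"
proof -
  let ?L = "Leb_d d"
  interpret complete_measure ?L
    unfolding Leb_d_def by (rule completion.complete_measure_axioms)
  define U where "U = {x \<in> space ?L. \<exists>\<rho>>0. \<forall>y\<in>space ?L. dist_d d x y < \<rho> \<longrightarrow> f y = 1}"
  have tri: "dist_d d x z \<le> dist_d d x y + dist_d d y z" for x y z
    using L2_set_triangle_ineq[of "\<lambda>i. x i - y i" "\<lambda>i. y i - z i" "{..<d}"]
    by (simp add: dist_d_def L2_set_def)
  have "U \<in> sets ?L"
  proof (rule sets_Leb_d_dist_open)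
    fix x assume "x \<in> U"
    then obtain \<rho> where \<rho>: "\<rho> > 0" "\<forall>y\<in>space ?L. dist_d d x y < \<rho> \<longrightarrow> f y = 1"
      by (auto simp: U_def)
    have "y \<in> U" if y: "y \<in> space ?L" "dist_d d x y < \<rho> / 2" for y
    proof -
      have "f z = 1" if "z \<in> space ?L" "dist_d d y z < \<rho> / 2" for z
        using tri[of x z y] y that \<rho> by auto
      then show ?thesis
        using y \<rho>(1) by (auto simp: U_def intro!: exI[of _ "\<rho> / 2"])
    qed
    then show "\<exists>\<rho>>0. \<forall>y\<in>space ?L. dist_d d x y < \<rho> \<longrightarrow> y \<in> U"
      using \<rho>(1) by (intro exI[of _ "\<rho> / 2"]) auto
  qed (auto simp: U_def)
  moreover have "AE x in ?L. x \<in> U \<longleftrightarrow> x \<in> {x \<in> space ?L. f x = 1}"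
    using lc AE_space
  proof eventually_elim
    case (elim x)
    then show ?case
      by (force simp: U_def locally_const_at_d_def)
  qed
  ultimately have A: "{x \<in> space ?L. f x = 1} \<in> sets ?L"
    by (intro in_sets_AE[of U "{x \<in> space ?L. f x = 1}"]) simp_all
  have "(\<lambda>x. if f x = 1 then 1 else -1 :: real) \<in> borel_measurable ?L"
    using A by (intro measurable_If) simp_all
  then show ?thesis
    by (rule measurable_cong[THEN iffD1, rotated]) (use f in auto)
qed

subsection \<open>One-dimensional estimates\<close>

text \<open>Sum of the geometric series with first term 4 and ratio 2^(1-r), which arises from the
  dyadic shells in \<open>far_moment\<close>.\<close>

definition tail_const :: "real \<Rightarrow> real" where
  "tail_const r = 4 / (1 - 2 powr (1 - r))"

lemma tail_const_ge:
  assumes "r > 1"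
  shows "tail_const r \<ge> 4"
proof -
  have "2 powr (1 - r) < 2 powr (0::real)"
    using assms by (intro powr_less_mono) auto
  then show ?thesis
    by (simp add: tail_const_def field_simps)
qed

lemma nn_integral_if_1_0:
  assumes "{z \<in> space M. P z} \<in> sets M"
  shows "(\<integral>\<^sup>+z. (if P z then 1 else 0) \<partial>M) = emeasure M {z \<in> space M. P z}"
proof -
  have "(\<integral>\<^sup>+z. (if P z then 1 else 0) \<partial>M) = (\<integral>\<^sup>+z. indicator {z \<in> space M. P z} z \<partial>M)"
    by (intro nn_integral_cong) (simp add: indicator_def)
  then show ?thesis
    using assms by simp
qed

text \<open>Cutting off at \<open>t\<close> bounds the weight by t^(-r); without the cut the
  exponential moment used below would be infinite.\<close>

definition far_weight :: "real \<Rightarrow> real \<Rightarrow> real \<Rightarrow> real" where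
  "far_weight r t \<tau> = (if \<tau> > t then \<tau> powr (- r) else 0)"

lemma far_weight_nonneg [simp]: "far_weight r t \<tau> \<ge> 0"
  by (simp add: far_weight_def)

lemma far_weight_measurable [measurable]: "far_weight r t \<in> borel_measurable borel"
  unfolding far_weight_def by measurable

text \<open>What remains of the geometry: up to a factor 2, T behaves near 0 like a uniform variable
  on [0,1]. Beyond \<open>u0\<close> nothing is assumed about the distribution, but there a weight
  is at most \<open>u0 powr (- r)\<close>.\<close>

locale radial_scale = prob_space D for D :: "'a measure" +
  fixes T :: "'a \<Rightarrow> real" and r u0 :: real
  assumes T_measurable [measurable]: "T \<in> borel_measurable D"
    and r: "r > 1" and u0: "u0 > 0"
    and cdf_lower: "\<And>u. 0 < u \<Longrightarrow> u \<le> u0 \<Longrightarrow> u / 2 \<le> prob {z \<in> space D. T z \<le> u}"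
    and cdf_upper: "\<And>u. 0 < u \<Longrightarrow> u \<le> u0 \<Longrightarrow> prob {z \<in> space D. T z \<le> u} \<le> 2 * u"
begin

abbreviation far :: "real \<Rightarrow> 'a \<Rightarrow> real" where
  "far t z \<equiv> far_weight r t (T z)"

lemma far_le:
  assumes "t > 0"
  shows "far t z \<le> t powr (- r)"
  using assms r by (auto simp: far_weight_def intro!: powr_mono2')

text \<open>A point with 2^j t < T \<le> 2^(j+1) t has weight at most (2^j t)^(-r). The terms use
  whole balls instead of shells because \<open>cdf_upper\<close> measures balls, and they are cut at
  \<open>u0\<close>, where that bound stops.\<close>

lemma far_le_dyadic:
  assumes t: "t > 0"
  shows "ennreal (far t z) \<le> (\<Sum>j. ennreal ((2 ^ j * t) powr (- r)) *
      (if T z \<le> min u0 (2 ^ Suc j * t) then 1 else 0)) + ennreal (u0 powr (- r))"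
    (is "_ \<le> suminf ?g + _")
proof -
  consider "T z \<le> t" | "T z > t" "T z > u0" | "T z > t" "T z \<le> u0" by linarith
  then show ?thesis
  proof cases
    case 2
    then have "far t z \<le> u0 powr (- r)"
      using u0 r by (auto simp: far_weight_def intro!: powr_mono2')
    then show ?thesis
      by (intro add_increasing ennreal_leI) auto
  next
    case 3
    \<comment> \<open>The shell index is \<open>n - 1\<close>; the case \<open>n = 0\<close> is
      excluded by \<open>T z > t\<close>.\<close>
    define n where "n = (LEAST n. T z \<le> 2 ^ n * t)"
    obtain k where "T z / t < 2 ^ k"
      using real_arch_pow[of 2 "T z / t"] by auto
    then have "T z \<le> 2 ^ k * t"
      using t by (simp add: field_simps)
    then have n: "T z \<le> 2 ^ n * t"
      unfolding n_def by (rule LeastI)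
    with 3 obtain j where j: "n = Suc j"
      by (cases n) auto
    have "\<not> T z \<le> 2 ^ j * t"
      using not_less_Least[of j "\<lambda>n. T z \<le> 2 ^ n * t"] j by (auto simp: n_def)
    then have "T z powr (- r) \<le> (2 ^ j * t) powr (- r)"
      using t r by (intro powr_mono2') auto
    then have "ennreal (far t z) \<le> ?g j"
      using 3 n j by (auto simp: far_weight_def intro!: ennreal_leI)
    also have "\<dots> \<le> suminf ?g"
      using sum_le_suminf[of ?g "{j}"] by simp
    finally show ?thesis
      by (rule add_increasing2[rotated]) simp
  qed (simp add: far_weight_def)
qed

text \<open>The j-th dyadic term contributes at most (2^j t)^(-r) times 2 * 2^(j+1) t, that is 4
  t^(1-r) q^j with q = 2^(1-r). Summability of these terms is where \<open>r > 1\<close>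
  enters.\<close>

lemma far_moment:
  assumes t: "t > 0"
  shows "(\<integral>\<^sup>+z. ennreal (far t z) \<partial>D)
    \<le> ennreal (tail_const r * t powr (1 - r) + u0 powr (- r))"
proof -
  define q where "q = 2 powr (1 - r)"
  have q: "0 \<le> q" "q < 1"
    using r powr_less_mono[of "1 - r" 0 "2::real"] by (simp_all add: q_def)
  let ?g = "\<lambda>j z. ennreal ((2 ^ j * t) powr (- r)) *
      (if T z \<le> min u0 (2 ^ Suc j * t) then 1 else 0)"
  have g: "(\<integral>\<^sup>+z. ?g j z \<partial>D) \<le> ennreal (4 * t powr (1 - r) * q ^ j)" for j
  proof -
    let ?u = "min u0 (2 ^ Suc j * t)"
    have "(\<integral>\<^sup>+z. (if T z \<le> ?u then 1 else 0) \<partial>D) = emeasure D {z \<in> space D. T z \<le> ?u}"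
      by (intro nn_integral_if_1_0) measurable
    also have "\<dots> \<le> ennreal (2 * ?u)"
      using cdf_upper[of ?u] u0 t by (simp add: emeasure_eq_measure ennreal_leI)
    also have "\<dots> \<le> ennreal (4 * 2 ^ j * t)"
      using min.cobounded2[of u0 "2 ^ Suc j * t"] by (intro ennreal_leI) (simp add: mult_ac)
    finally have *: "(\<integral>\<^sup>+z. (if T z \<le> ?u then 1 else 0) \<partial>D) \<le> ennreal (4 * 2 ^ j * t)"
      by simp
    have "(\<integral>\<^sup>+z. ?g j z \<partial>D)
        = ennreal ((2 ^ j * t) powr (- r)) * (\<integral>\<^sup>+z. (if T z \<le> ?u then 1 else 0) \<partial>D)"
      by (rule nn_integral_cmult) measurable
    also have "\<dots> \<le> ennreal ((2 ^ j * t) powr (- r)) * ennreal (4 * 2 ^ j * t)"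
      by (intro mult_left_mono *) simp
    also have "\<dots> = ennreal ((2 ^ j * t) powr (- r) * (4 * 2 ^ j * t))"
      using t by (simp add: ennreal_mult)
    also have "(2 ^ j * t) powr (- r) * (4 * 2 ^ j * t) = 4 * ((2 ^ j * t) powr (- r) * (2 ^ j * t) powr 1)"
      using t by simp
    also have "\<dots> = 4 * (2 ^ j * t) powr (1 - r)"
      by (subst powr_add[symmetric]) (simp add: algebra_simps)
    also have "\<dots> = 4 * t powr (1 - r) * (2 ^ j) powr (1 - r)"
      using t by (simp add: powr_mult)
    also have "(2 ^ j) powr (1 - r) = q ^ j"
      by (simp add: q_def powr_powr mult.commute flip: powr_realpow)
    finally show ?thesis .
  qed
  have "(\<lambda>j. 4 * t powr (1 - r) * q ^ j) sums (4 * t powr (1 - r) * (1 / (1 - q)))"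
    using q by (intro sums_mult geometric_sums) auto
  moreover have "4 * t powr (1 - r) * (1 / (1 - q)) = tail_const r * t powr (1 - r)"
    by (simp add: tail_const_def q_def)
  ultimately have S: "(\<lambda>j. 4 * t powr (1 - r) * q ^ j) sums (tail_const r * t powr (1 - r))"
    by simp
  have "(\<integral>\<^sup>+z. ennreal (far t z) \<partial>D) \<le> (\<integral>\<^sup>+z. (\<Sum>j. ?g j z) + ennreal (u0 powr (- r)) \<partial>D)"
    using far_le_dyadic[OF t] by (intro nn_integral_mono)
  also have "\<dots> = (\<Sum>j. \<integral>\<^sup>+z. ?g j z \<partial>D) + ennreal (u0 powr (- r))"
    by (subst nn_integral_add) (simp_all add: nn_integral_suminf emeasure_space_1)
  also have "(\<Sum>j. \<integral>\<^sup>+z. ?g j z \<partial>D) \<le> (\<Sum>j. ennreal (4 * t powr (1 - r) * q ^ j))"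
    by (intro suminf_le g) auto
  also have "\<dots> = ennreal (tail_const r * t powr (1 - r))"
    using q S by (subst suminf_ennreal2) (auto simp: sums_iff)
  finally show ?thesis
    using tail_const_ge[OF r] by (simp add: ennreal_plus)
qed

text \<open>On [0,1] one has exp x \<le> 1 + x + x^2 \<le> 1 + 2x, and the condition on
  \<open>lam\<close> keeps \<open>lam * far t z\<close> in that interval. The final passage from 1 +
  y to exp y prepares for taking the m-th power.\<close>

lemma far_exp_moment:
  assumes t: "t > 0" and lam: "0 \<le> lam" "lam * t powr (- r) \<le> 1"
  shows "(\<integral>\<^sup>+z. ennreal (exp (lam * far t z)) \<partial>D)
    \<le> ennreal (exp (2 * lam * (tail_const r * t powr (1 - r) + u0 powr (- r))))"
proof -
  let ?E = "tail_const r * t powr (1 - r) + u0 powr (- r)"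
  have E: "?E \<ge> 0"
    using tail_const_ge[OF r] by simp
  have "exp (lam * far t z) \<le> 1 + 2 * lam * far t z" for z
  proof -
    have x: "0 \<le> lam * far t z" "lam * far t z \<le> 1"
      using lam mult_left_mono[OF far_le[OF t] lam(1), of z] by auto
    then have "exp (lam * far t z) \<le> 1 + lam * far t z + (lam * far t z)\<^sup>2"
      by (rule exp_bound)
    also have "(lam * far t z)\<^sup>2 \<le> (lam * far t z) ^ 1"
      using x by (intro power_decreasing) auto
    finally show ?thesis by (simp only: power_one_right) linarith
  qed
  then have "(\<integral>\<^sup>+z. ennreal (exp (lam * far t z)) \<partial>D)
      \<le> (\<integral>\<^sup>+z. 1 + ennreal (2 * lam) * ennreal (far t z) \<partial>D)"
    using lam by (intro nn_integral_mono)
      (auto simp: ennreal_mult[symmetric] ennreal_leI simp flip: ennreal_1 ennreal_plus)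
  also have "\<dots> = 1 + ennreal (2 * lam) * (\<integral>\<^sup>+z. ennreal (far t z) \<partial>D)"
    by (subst nn_integral_add) (simp_all add: nn_integral_cmult emeasure_space_1)
  also have "\<dots> \<le> 1 + ennreal (2 * lam) * ennreal ?E"
    by (intro add_left_mono mult_left_mono far_moment t) simp
  also have "\<dots> = ennreal (1 + 2 * lam * ?E)"
    using lam E by (simp add: ennreal_mult ennreal_plus)
  also have "\<dots> \<le> ennreal (exp (2 * lam * ?E))"
    by (intro ennreal_leI exp_ge_add_one_self)
  finally show ?thesis .
qed


text \<open>The summands bound, in this order: no sample within a/m, a flipped sample within b/m,
  and the Chernoff bound for the far weights. The value of \<open>b\<close> makes the leading part
  of the Chernoff exponent, 2 * tail_const * a^(1+r) * b^(1-r), equal to a/4.\<close>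

lemma upper_estimate:
  assumes a: "a \<ge> 1" and p: "p \<ge> 0"
    and b: "b = (8 * tail_const r) powr (1 / (r - 1)) * a powr (r / (r - 1))"
  shows "eventually (\<lambda>m.
    (\<integral>\<^sup>+z. (if T z > a / real m then 1 else 0) \<partial>D) ^ m
    + of_nat m * (ennreal p * (\<integral>\<^sup>+z. (if T z \<le> b / real m then 1 else 0) \<partial>D))
    + ennreal (exp (- a)) *
      (\<integral>\<^sup>+z. ennreal (exp (a * (a / real m) powr r * far (b / real m) z)) \<partial>D) ^ m
    \<le> ennreal (2 * exp (- (a / 2)) + 2 * p * b)) sequentially"
proof -
  define C where "C = tail_const r"
  have C: "C \<ge> 4"
    using tail_const_ge[OF r] by (simp add: C_def)
  have b_pos: "b > 0"
    using a C by (simp add: b C_def[symmetric])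
  have b_powr: "b powr (1 - r) = a powr (- r) / (8 * C)"
  proof -
    have "1 / (r - 1) * (1 - r) = -1" "r / (r - 1) * (1 - r) = - r"
      using r by (simp_all add: field_simps)
    then show ?thesis
      using a C by (simp add: b C_def[symmetric] powr_mult powr_powr powr_minus field_simps)
  qed
  \<comment> \<open>Since b \<ge> a^(r/(r-1)) and r^2/(r-1) \<ge> r + 1. This yields
    \<open>lam * t powr (- r) \<le> 1\<close>, the condition of
    \<open>far_exp_moment\<close>.\<close>
  have "b powr (- r) \<le> a powr (- (1 + r))"
  proof -
    have "1 * a powr (r / (r - 1)) \<le> b"
      unfolding b C_def[symmetric] using C r by (intro mult_right_mono ge_one_powr_ge_zero) auto
    then have "b powr (- r) \<le> (a powr (r / (r - 1))) powr (- r)"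
      using r a by (intro powr_mono2') auto
    also have "\<dots> = a powr (- (r / (r - 1) * r))"
      by (simp add: powr_powr)
    also have "\<dots> \<le> a powr (- (1 + r))"
      using r a by (intro powr_mono) (auto simp: field_simps)
    finally show ?thesis .
  qed
  then have "a powr (1 + r) * b powr (- r) \<le> a powr (1 + r) * a powr (- (1 + r))"
    by (intro mult_left_mono) auto
  also have "\<dots> = 1"
    using a by (simp flip: powr_add)
  finally have lam_le: "a powr (1 + r) * b powr (- r) \<le> 1" .
  have lim: "((\<lambda>m. real m powr (1 - r)) \<longlongrightarrow> 0) sequentially"
    using r by (intro tendsto_neg_powr filterlim_real_sequentially) auto
  then have "((\<lambda>m. 2 * a powr (1 + r) * u0 powr (- r) * real m powr (1 - r))
      \<longlongrightarrow> 2 * a powr (1 + r) * u0 powr (- r) * 0) sequentially"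
    by (intro tendsto_mult tendsto_const)
  \<comment> \<open>The contribution of samples beyond \<open>u0\<close> to the exponent is made
    smaller than the second quarter of a.\<close>
  then have "eventually (\<lambda>m. 2 * a powr (1 + r) * u0 powr (- r) * real m powr (1 - r) < a / 4) sequentially"
    using a by (intro order_tendstoD(2)) auto
  moreover have "eventually (\<lambda>m. c / real m < u0) sequentially" for c
    using u0 by (intro order_tendstoD(2)[OF lim_const_over_n]) auto
  then have "eventually (\<lambda>m. a / real m < u0) sequentially" "eventually (\<lambda>m. b / real m < u0) sequentially"
    by blast+
  moreover have "eventually (\<lambda>m. m > 0) sequentially"
    by (rule eventually_gt_at_top)
  ultimately show ?thesis
  proof eventually_elim
    case (elim m)
    define M where "M = real m"
    define s where "s = a / M"
    define t where "t = b / M"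
    \<comment> \<open>Normalised so that \<open>lam\<close> times the threshold
      \<open>s powr (- r)\<close> is exactly a, the source of the factor exp (- a).\<close>
    define lam where "lam = a * s powr r"
    have M: "M > 0" and s: "0 < s" "s \<le> u0" and t: "0 < t" "t \<le> u0"
      using elim a b_pos by (auto simp: M_def s_def t_def)
    have "(\<integral>\<^sup>+z. (if T z > s then 1 else 0) \<partial>D) ^ m \<le> ennreal (exp (- (a / 2)))"
    proof -
      have "(\<integral>\<^sup>+z. (if T z > s then 1 else 0) \<partial>D) = emeasure D {z \<in> space D. T z > s}"
        by (intro nn_integral_if_1_0) measurable
      also have "\<dots> = ennreal (1 - prob {z \<in> space D. T z \<le> s})"
        by (subst prob_compl[symmetric])
          (auto simp: emeasure_eq_measure not_le intro!: arg_cong[where f = "measure D"])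
      also have "\<dots> \<le> ennreal (exp (- (s / 2)))"
        using cdf_lower[OF s] exp_ge_add_one_self[of "- (s / 2)"] by (intro ennreal_leI) linarith
      finally have "(\<integral>\<^sup>+z. (if T z > s then 1 else 0) \<partial>D) ^ m \<le> ennreal (exp (- (s / 2))) ^ m"
        by (rule power_mono) simp
      also have "\<dots> = ennreal (exp (- (a / 2)))"
        using M by (simp add: ennreal_power s_def M_def flip: exp_of_nat_mult)
      finally show ?thesis .
    qed
    moreover have "of_nat m * (ennreal p * (\<integral>\<^sup>+z. (if T z \<le> t then 1 else 0) \<partial>D)) \<le> ennreal (2 * p * b)"
    proof -
      have "(\<integral>\<^sup>+z. (if T z \<le> t then 1 else 0) \<partial>D) = emeasure D {z \<in> space D. T z \<le> t}"
        by (intro nn_integral_if_1_0) measurable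
      also have "\<dots> \<le> ennreal (2 * t)"
        using cdf_upper[OF t] by (simp add: emeasure_eq_measure ennreal_leI)
      finally have "of_nat m * (ennreal p * (\<integral>\<^sup>+z. (if T z \<le> t then 1 else 0) \<partial>D))
          \<le> of_nat m * (ennreal p * ennreal (2 * t))"
        by (intro mult_left_mono) auto
      also have "\<dots> = ennreal (M * (p * (2 * t)))"
        using p t M by (simp add: ennreal_mult M_def ennreal_of_nat_eq_real_of_nat)
      also have "M * (p * (2 * t)) = 2 * p * b"
        using M by (simp add: t_def)
      finally show ?thesis .
    qed
    moreover have "ennreal (exp (- a)) * (\<integral>\<^sup>+z. ennreal (exp (lam * far t z)) \<partial>D) ^ m
        \<le> ennreal (exp (- (a / 2)))"
    proof -
      define E where "E = 2 * lam * (C * t powr (1 - r) + u0 powr (- r))"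
      have "lam * t powr (- r) = a powr (1 + r) * b powr (- r)"
        using a b_pos M
        by (simp add: lam_def s_def t_def powr_divide powr_minus powr_add field_simps)
      then have "(\<integral>\<^sup>+z. ennreal (exp (lam * far t z)) \<partial>D) \<le> ennreal (exp E)"
        unfolding E_def C_def using lam_le a by (intro far_exp_moment t) (auto simp: lam_def)
      then have "ennreal (exp (- a)) * (\<integral>\<^sup>+z. ennreal (exp (lam * far t z)) \<partial>D) ^ m
          \<le> ennreal (exp (- a)) * ennreal (exp E) ^ m"
        by (intro mult_left_mono power_mono) auto
      also have "\<dots> = ennreal (exp (- a + M * E))"
        by (simp add: ennreal_power ennreal_mult[symmetric] M_def exp_of_nat_mult[symmetric]
            exp_add[symmetric])
      \<comment> \<open>Of the gain a, one quarter is spent on the dyadic tail and at most one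
        quarter on samples beyond \<open>u0\<close>.\<close>
      also have "- a + M * E \<le> - (a / 2)"
      proof -
        have 1: "M * s powr r = a powr r * M powr (1 - r)"
          using a M by (simp add: s_def powr_divide powr_diff)
        have 2: "M powr (1 - r) * t powr (1 - r) = b powr (1 - r)"
          using M b_pos by (simp add: t_def powr_divide)
        have "M * E = 2 * a * (M * s powr r) * (C * t powr (1 - r) + u0 powr (- r))"
          by (simp add: E_def lam_def)
        also have "\<dots> = 2 * a * a powr r * C * (M powr (1 - r) * t powr (1 - r))
            + 2 * (a * a powr r) * u0 powr (- r) * M powr (1 - r)"
          unfolding 1 by (simp add: algebra_simps)
        also have "\<dots> = a / 4 + 2 * a powr (1 + r) * u0 powr (- r) * M powr (1 - r)"
          unfolding 2 b_powr using a C by (simp add: powr_add powr_minus field_simps)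
        also have "\<dots> \<le> a / 4 + a / 4"
          using elim by (simp add: M_def)
        finally show ?thesis by simp
      qed
      finally show ?thesis by (simp add: ennreal_leI)
    qed
    ultimately have "(\<integral>\<^sup>+z. (if T z > s then 1 else 0) \<partial>D) ^ m
      + of_nat m * (ennreal p * (\<integral>\<^sup>+z. (if T z \<le> t then 1 else 0) \<partial>D))
      + ennreal (exp (- a)) * (\<integral>\<^sup>+z. ennreal (exp (lam * far t z)) \<partial>D) ^ m
      \<le> ennreal (exp (- (a / 2))) + ennreal (2 * p * b) + ennreal (exp (- (a / 2)))"
      by (intro add_mono)
    also have "\<dots> = ennreal (2 * exp (- (a / 2)) + 2 * p * b)"
      using p b_pos by (simp add: ennreal_plus[symmetric] del: ennreal_plus)
    finally show ?case
      by (simp add: s_def t_def lam_def M_def)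
  qed
qed

text \<open>The double product dominates the expected number of pairs of a near sample and another
  one disturbing it. It is at most half the expected number of near samples, which itself is at
  least a/2, so a/4 is left. The additive form avoids subtraction in \<open>ennreal\<close>.\<close>

lemma lower_estimate:
  assumes a: "a = (1 / (tail_const r * 8 powr r)) powr (1 / r)"
  shows "eventually (\<lambda>m.
    ennreal (a / 4) + of_nat m * (of_nat m * (emeasure D {z \<in> space D. T z \<le> a / real m} *
      (\<integral>\<^sup>+z. (if T z \<le> (1 / 8) / real m then 1 else 0)
          + ennreal ((a / real m) powr r * far ((1 / 8) / real m) z) \<partial>D)))
    \<le> of_nat m * emeasure D {z \<in> space D. T z \<le> a / real m}) sequentially"
proof -
  define C where "C = tail_const r"
  define b :: real where "b = 1 / 8"
  have C: "C \<ge> 4"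
    using tail_const_ge[OF r] by (simp add: C_def)
  have a_pos: "a > 0"
    using C by (simp add: a C_def[symmetric])
  \<comment> \<open>The equation that determines \<open>a\<close>. Together with 2b = 1/4 and 1/8
    for samples beyond \<open>u0\<close> it bounds the mean disturbance \<open>M * k\<close> by
    1/2.\<close>
  have a_powr: "a powr r * C * b powr (1 - r) = 1 / 8"
    using C r unfolding a C_def[symmetric] b_def
    by (simp add: powr_powr powr_divide powr_diff powr_minus field_simps)
  have lim: "((\<lambda>m. real m powr (1 - r)) \<longlongrightarrow> 0) sequentially"
    using r by (intro tendsto_neg_powr filterlim_real_sequentially) auto
  then have "((\<lambda>m. a powr r * u0 powr (- r) * real m powr (1 - r))
      \<longlongrightarrow> a powr r * u0 powr (- r) * 0) sequentially"
    by (intro tendsto_mult tendsto_const)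
  then have "eventually (\<lambda>m. a powr r * u0 powr (- r) * real m powr (1 - r) < 1 / 8) sequentially"
    by (intro order_tendstoD(2)) auto
  moreover have "eventually (\<lambda>m. c / real m < u0) sequentially" for c
    using u0 by (intro order_tendstoD(2)[OF lim_const_over_n]) auto
  then have "eventually (\<lambda>m. a / real m < u0) sequentially" "eventually (\<lambda>m. b / real m < u0) sequentially"
    by blast+
  moreover have "eventually (\<lambda>m. m > 0) sequentially"
    by (rule eventually_gt_at_top)
  ultimately show ?thesis
  proof eventually_elim
    case (elim m)
    define M where "M = real m"
    define s where "s = a / M"
    define t where "t = b / M"
    have M: "M > 0" and s: "0 < s" "s \<le> u0" and t: "0 < t" "t \<le> u0"
      using elim a_pos by (auto simp: M_def s_def t_def b_def)
    define k where "k = 2 * t + s powr r * (C * t powr (1 - r) + u0 powr (- r))"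
    have k: "k \<ge> 0"
      using t C by (simp add: k_def)
    let ?EK = "\<integral>\<^sup>+z. (if T z \<le> t then 1 else 0) + ennreal (s powr r * far t z) \<partial>D"
    let ?P = "prob {z \<in> space D. T z \<le> s}"
    have "?EK = emeasure D {z \<in> space D. T z \<le> t} + ennreal (s powr r) * (\<integral>\<^sup>+z. ennreal (far t z) \<partial>D)"
      by (subst nn_integral_add)
        (simp_all add: ennreal_mult nn_integral_cmult nn_integral_if_1_0)
    also have "\<dots> \<le> ennreal (2 * t) + ennreal (s powr r) * ennreal (C * t powr (1 - r) + u0 powr (- r))"
      unfolding C_def using cdf_upper[OF t]
      by (intro add_mono mult_left_mono far_moment t) (simp_all add: emeasure_eq_measure ennreal_leI)
    also have "\<dots> = ennreal k"
      using t C by (simp add: k_def ennreal_mult ennreal_plus)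
    finally have EK: "?EK \<le> ennreal k" .
    have Mk: "M * k \<le> 1 / 2"
    proof -
      have 1: "M * s powr r = a powr r * M powr (1 - r)"
        using a_pos M by (simp add: s_def powr_divide powr_diff)
      have 2: "M powr (1 - r) * t powr (1 - r) = b powr (1 - r)"
        using M by (simp add: t_def powr_divide)
      have "M * k = 2 * (M * t) + (M * s powr r) * (C * t powr (1 - r) + u0 powr (- r))"
        by (simp add: k_def algebra_simps)
      also have "\<dots> = 2 * b + a powr r * C * (M powr (1 - r) * t powr (1 - r))
          + a powr r * u0 powr (- r) * M powr (1 - r)"
        unfolding 1 using M by (simp add: algebra_simps t_def)
      also have "\<dots> \<le> 2 * b + 1 / 8 + 1 / 8"
        unfolding 2 a_powr using elim by (simp add: M_def)
      finally show ?thesis by (simp add: b_def)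
    qed
    have "a / 2 \<le> M * ?P"
      using cdf_lower[OF s] M by (simp add: s_def field_simps)
    moreover have "(M * ?P) * (M * k) \<le> (M * ?P) * (1 / 2)"
      using Mk M by (intro mult_left_mono) auto
    ultimately have *: "a / 4 + M * (M * (?P * k)) \<le> M * ?P"
      by (simp add: algebra_simps)
    have "ennreal (a / 4) + of_nat m * (of_nat m * (emeasure D {z \<in> space D. T z \<le> s} * ?EK))
        \<le> ennreal (a / 4) + of_nat m * (of_nat m * (ennreal ?P * ennreal k))"
      unfolding emeasure_eq_measure by (intro add_left_mono mult_left_mono EK) auto
    also have "\<dots> = ennreal (a / 4 + M * (M * (?P * k)))"
      using a_pos k M by (simp add: ennreal_plus ennreal_mult M_def ennreal_of_nat_eq_real_of_nat)
    also have "\<dots> \<le> ennreal (M * ?P)"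
      using * by (rule ennreal_leI)
    also have "\<dots> = of_nat m * emeasure D {z \<in> space D. T z \<le> s}"
      using M by (simp add: ennreal_mult M_def ennreal_of_nat_eq_real_of_nat emeasure_eq_measure)
    finally show ?case
      by (simp add: s_def t_def b_def M_def)
  qed
qed

end

subsection \<open>Pointwise bounds on the error\<close>

definition flip_weight :: "real \<Rightarrow> nat \<Rightarrow> nat set \<Rightarrow> real" where
  "flip_weight p m F = p ^ card F * (1 - p) ^ (m - card F)"

lemma flip_weight_nonneg: "0 \<le> p \<Longrightarrow> p \<le> 1 \<Longrightarrow> flip_weight p m F \<ge> 0"
  by (simp add: flip_weight_def)

lemma sum_flip_weight: "(\<Sum>F\<in>Pow {..<m}. flip_weight p m F) = 1"
proof -
  have "(\<Sum>F\<in>Pow {..<m}. flip_weight p m F)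
      = (\<Sum>F\<in>Pow {..<m}. (\<Prod>i\<in>F. p) * (\<Prod>i\<in>{..<m} - F. 1 - p))"
    by (intro sum.cong) (auto simp: flip_weight_def card_Diff_subset finite_subset)
  also have "\<dots> = (\<Prod>i<m. p + (1 - p))"
    by (rule prod_add[symmetric]) simp
  finally show ?thesis
    by simp
qed

text \<open>The marginal flip probability. In the expansion of the product over all samples the
  factor 1 - p at \<open>i\<close> is replaced by 0, so exactly the subsets missing \<open>i\<close>
  drop out.\<close>

lemma sum_flip_weight_mem:
  assumes "i < m"
  shows "(\<Sum>F\<in>Pow {..<m}. flip_weight p m F * (if i \<in> F then 1 else 0)) = p"
proof -
  define b where "b = (\<lambda>j. if j = i then 0 else 1 - p)"
  have "(\<Sum>F\<in>Pow {..<m}. flip_weight p m F * (if i \<in> F then 1 else 0))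
      = (\<Sum>F\<in>Pow {..<m}. (\<Prod>j\<in>F. p) * (\<Prod>j\<in>{..<m} - F. b j))"
  proof (intro sum.cong refl)
    fix F assume F: "F \<in> Pow {..<m}"
    show "flip_weight p m F * (if i \<in> F then 1 else 0) = (\<Prod>j\<in>F. p) * (\<Prod>j\<in>{..<m} - F. b j)"
    proof (cases "i \<in> F")
      case True
      then have "(\<Prod>j\<in>{..<m} - F. b j) = (\<Prod>j\<in>{..<m} - F. 1 - p)"
        by (intro prod.cong) (auto simp: b_def)
      then show ?thesis
        using F True by (auto simp: flip_weight_def card_Diff_subset finite_subset)
    next
      case False
      then have "(\<Prod>j\<in>{..<m} - F. b j) = 0"
        using assms by (intro prod_zero) (auto simp: b_def)
      then show ?thesis
        using False by simp
    qed
  qed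
  also have "\<dots> = (\<Prod>j<m. p + b j)"
    by (rule prod_add[symmetric]) simp
  also have "\<dots> = (\<Prod>j<m. if j = i then p else 1)"
    by (intro prod.cong) (auto simp: b_def)
  finally show ?thesis
    using assms by simp
qed

text \<open>\<open>h j\<close> caps how hard voter j can push against \<eta>, so a supporter may
  have cap 0. It serves both bounds, with \<eta> the true label for a correct vote and its negative
  for a wrong one.\<close>

lemma sgn_sum_dominant:
  fixes y w h :: "'i \<Rightarrow> real"
  assumes "finite I" "i \<in> I" and \<eta>: "\<eta> \<in> {-1, 1}" and "y i = \<eta>"
    and h: "\<And>j. j \<in> I - {i} \<Longrightarrow> - (\<eta> * y j * w j) \<le> h j"
    and dom: "(\<Sum>j\<in>I - {i}. h j) < w i"
  shows "sgn (\<Sum>j\<in>I. y j * w j) = \<eta>"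
proof -
  have \<eta>2: "\<eta> * \<eta> = 1"
    using \<eta> by auto
  have "(\<Sum>j\<in>I - {i}. - (\<eta> * y j * w j)) \<le> (\<Sum>j\<in>I - {i}. h j)"
    by (intro sum_mono h)
  then have "- (\<Sum>j\<in>I - {i}. \<eta> * y j * w j) < w i"
    using dom by (simp add: sum_negf)
  moreover have "\<eta> * (\<Sum>j\<in>I. y j * w j) = \<eta> * y i * w i + (\<Sum>j\<in>I - {i}. \<eta> * y j * w j)"
    using assms(1,2) by (simp add: sum.remove[of I i] sum_distrib_left distrib_left mult.assoc)
  ultimately have "\<eta> * (\<Sum>j\<in>I. y j * w j) > 0"
    using \<eta>2 \<open>y i = \<eta>\<close> by simp
  then show ?thesis
    using \<eta> by (auto simp: sgn_if)
qed

lemma dist_d_eq_0: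
  assumes "x \<in> space (Leb_d d)" "y \<in> space (Leb_d d)" "dist_d d x y = 0"
  shows "x = y"
proof (rule extensionalityI)
  show "x \<in> extensional {..<d}" "y \<in> extensional {..<d}"
    using assms by (simp_all add: space_Leb_d)
  have "(\<Sum>i<d. (x i - y i)\<^sup>2) = 0"
    using assms(3) by (simp add: dist_d_def)
  then show "x i = y i" if "i \<in> {..<d}" for i
    using that by (simp add: sum_nonneg_eq_0_iff)
qed

definition vol_scale :: "nat \<Rightarrow> real \<Rightarrow> (nat \<Rightarrow> real) \<Rightarrow> (nat \<Rightarrow> real) \<Rightarrow> real" where
  "vol_scale d \<kappa> x z = \<kappa> * dist_d d x z ^ d"

text \<open>Since r = \<beta>/d, raising the distance to the power d turns the weight exponent
  \<beta> into r, and the common positive factor \<open>\<kappa> powr r\<close> leaves the sign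
  unchanged.\<close>

lemma NW_interp_vol_scale:
  assumes "d \<ge> 1" "\<kappa> > 0" "\<not> (\<exists>i<m. zs i = x)"
  shows "NW_interp d \<beta> m zs ys x
    = sgn (\<Sum>i<m. ys i * vol_scale d \<kappa> x (zs i) powr (- (\<beta> / real d)))"
proof -
  define r where "r = \<beta> / real d"
  have w: "dist_d d x z powr (- \<beta>) = \<kappa> powr r * vol_scale d \<kappa> x z powr (- r)" for z
  proof -
    have "(dist_d d x z ^ d) powr (- r) = dist_d d x z powr (- \<beta>)"
    proof (cases "dist_d d x z = 0")
      case False
      then have "dist_d d x z > 0"
        using dist_d_nonneg[of d x z] by simp
      then show ?thesis
        using assms(1) by (simp add: powr_powr r_def flip: powr_realpow)
    qed (use assms(1) in simp)
    then show ?thesis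
      using assms(2) dist_d_nonneg[of d x z]
      by (simp add: vol_scale_def powr_mult powr_minus)
  qed
  have "NW_interp d \<beta> m zs ys x = sgn (\<Sum>i<m. ys i * dist_d d x (zs i) powr (- \<beta>))"
    using assms(3) by (auto simp: NW_interp_def)
  also have "(\<Sum>i<m. ys i * dist_d d x (zs i) powr (- \<beta>))
      = \<kappa> powr r * (\<Sum>i<m. ys i * vol_scale d \<kappa> x (zs i) powr (- r))"
    unfolding w by (simp add: sum_distrib_left mult_ac)
  finally show ?thesis
    using assms(2) by (simp add: sgn_mult r_def)
qed

text \<open>Several samples may coincide with \<open>x\<close>. Which label is copied is hidden
  here, so the uses below have to cover every coinciding index.\<close>

lemma NW_interp_coincidence:
  assumes "zs i = x" "i < m"
  obtains k where "k < m" "zs k = x" "NW_interp d \<beta> m zs ys x = ys k"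
proof -
  define k where "k = (LEAST i. i < m \<and> zs i = x)"
  have "k < m \<and> zs k = x"
    unfolding k_def by (rule LeastI[of _ i]) (use assms in simp)
  moreover have "NW_interp d \<beta> m zs ys x = ys k"
    using assms by (auto simp: NW_interp_def k_def)
  ultimately show ?thesis
    using that by blast
qed

section \<open>The vote for one fixed sample and one fixed test point\<close>

context
  fixes d m :: nat and \<beta> r \<kappa> :: real and f :: "(nat \<Rightarrow> real) \<Rightarrow> real"
    and zs :: "nat \<Rightarrow> nat \<Rightarrow> real" and x :: "nat \<Rightarrow> real" and T :: "nat \<Rightarrow> real"
    and s t :: real
  assumes d: "d \<ge> 1" and \<beta>: "\<beta> > real d" and r_def: "r = \<beta> / real d" and \<kappa>: "\<kappa> > 0"
    and f: "\<forall>x\<in>space (Leb_d d). f x \<in> {-1, 1}"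
    and zs: "\<And>i. i < m \<Longrightarrow> zs i \<in> space (Leb_d d)" and x: "x \<in> space (Leb_d d)"
    and T_def: "T = (\<lambda>i. vol_scale d \<kappa> x (zs i))"
    and st: "0 < s" "s \<le> t"
begin

private abbreviation err :: "nat set \<Rightarrow> bool" where
  "err F \<equiv> NW_interp d \<beta> m zs (\<lambda>i. if i \<in> F then - f (zs i) else f (zs i)) x \<noteq> f x"

private lemma r_gt_1: "r > 1"
  using d \<beta> by (simp add: r_def)

private lemma T_self: "zs i = x \<Longrightarrow> T i = 0"
  using d by (simp add: T_def vol_scale_def)

private lemma T_pos:
  assumes "i < m" "zs i \<noteq> x"
  shows "T i > 0"
proof -
  have "dist_d d x (zs i) \<noteq> 0"
    using dist_d_eq_0[OF x zs] assms by metis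
  then have "dist_d d x (zs i) > 0"
    using dist_d_nonneg[of d x "zs i"] by simp
  then show ?thesis
    using \<kappa> by (simp add: T_def vol_scale_def)
qed

private lemma weight_ge:
  assumes "i < m" "zs i \<noteq> x" "T i \<le> s"
  shows "T i powr (- r) \<ge> s powr (- r)"
  using assms T_pos r_gt_1 by (intro powr_mono2') auto

text \<open>All samples within \<open>t\<close> vote correctly, the near one with weight at least
  \<open>s powr (- r)\<close>, and the rest cannot outweigh it. A sample equal to \<open>x\<close>
  has T = 0, so it falls under \<open>clean\<close>.\<close>

private lemma NW_correct:
  assumes near: "i < m" "T i \<le> s"
    and clean: "\<And>j. j < m \<Longrightarrow> T j \<le> t \<Longrightarrow> j \<notin> F \<and> f (zs j) = f x"
    and far: "(\<Sum>j<m. far_weight r t (T j)) < s powr (- r)"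
  shows "\<not> err F"
proof (cases "\<exists>i<m. zs i = x")
  case True
  then obtain i where i: "zs i = x" "i < m" by blast
  obtain k where k: "k < m" "zs k = x"
    "NW_interp d \<beta> m zs (\<lambda>i. if i \<in> F then - f (zs i) else f (zs i)) x
      = (if k \<in> F then - f (zs k) else f (zs k))"
    by (rule NW_interp_coincidence[where zs = zs and ys = "\<lambda>i. if i \<in> F then - f (zs i) else f (zs i)", OF i])
  then show ?thesis
    using clean[of k] st by (simp add: T_self)
next
  case False
  let ?y = "\<lambda>i. if i \<in> F then - f (zs i) else f (zs i)"
  have \<eta>: "f x \<in> {-1, 1}"
    using f x by blast
  have "sgn (\<Sum>j<m. ?y j * T j powr (- r)) = f x"
  proof (rule sgn_sum_dominant[where i = i and h = "\<lambda>j. far_weight r t (T j)"])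
    show "?y i = f x"
      using clean[OF near(1)] near(2) st by auto
    show "- (f x * ?y j * T j powr (- r)) \<le> far_weight r t (T j)" if "j \<in> {..<m} - {i}" for j
    proof (cases "T j \<le> t")
      case True
      then show ?thesis
        using clean[of j] that \<eta> by (auto simp: far_weight_def)
    next
      case False
      have "f (zs j) \<in> {-1, 1}"
        using f zs that by auto
      then show ?thesis
        using \<eta> False by (auto simp: far_weight_def)
    qed
    have "(\<Sum>j\<in>{..<m} - {i}. far_weight r t (T j)) \<le> (\<Sum>j<m. far_weight r t (T j))"
      by (intro sum_mono2) auto
    then show "(\<Sum>j\<in>{..<m} - {i}. far_weight r t (T j)) < T i powr (- r)"
      using far weight_ge[of i] near False by auto
  qed (use near \<eta> in auto)
  then show ?thesis
    using NW_interp_vol_scale[OF d \<kappa> False] by (simp add: T_def r_def)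
qed

text \<open>The flipped sample \<open>i\<close> alone outweighs all others, even if every one of
  them votes correctly. A sample equal to \<open>x\<close> has T = 0, so \<open>others\<close>
  forces it to be \<open>i\<close>.\<close>

private lemma NW_wrong:
  assumes near: "i < m" "T i \<le> s" "i \<in> F" "f (zs i) = f x"
    and others: "\<And>j. j < m \<Longrightarrow> j \<noteq> i \<Longrightarrow> T j > t"
    and far: "(\<Sum>j\<in>{..<m} - {i}. far_weight r t (T j)) < s powr (- r)"
  shows "err F"
proof -
  let ?y = "\<lambda>i. if i \<in> F then - f (zs i) else f (zs i)"
  have \<eta>: "f x \<in> {-1, 1}"
    using f x by blast
  have "NW_interp d \<beta> m zs ?y x = - f x"
  proof (cases "\<exists>i<m. zs i = x")
    case True
    then obtain j where j: "zs j = x" "j < m" by blast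
    obtain k where k: "k < m" "zs k = x" "NW_interp d \<beta> m zs ?y x = ?y k"
      by (rule NW_interp_coincidence[where zs = zs and ys = ?y, OF j])
    moreover have "k = i"
      using others[of k] k st T_self[of k] by auto
    ultimately show ?thesis
      using near by simp
  next
    case False
    have "sgn (\<Sum>j<m. ?y j * T j powr (- r)) = - f x"
    proof (rule sgn_sum_dominant[where i = i and h = "\<lambda>j. far_weight r t (T j)"])
      show "- (- f x * ?y j * T j powr (- r)) \<le> far_weight r t (T j)" if "j \<in> {..<m} - {i}" for j
      proof -
        have "f (zs j) \<in> {-1, 1}" "T j > t"
          using f zs that others by auto
        then show ?thesis
          using \<eta> by (auto simp: far_weight_def)
      qed
      show "(\<Sum>j\<in>{..<m} - {i}. far_weight r t (T j)) < T i powr (- r)"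
        using far weight_ge[of i] near False by auto
    qed (use near \<eta> in auto)
    then show ?thesis
      using NW_interp_vol_scale[OF d \<kappa> False] by (simp add: T_def r_def)
  qed
  then show ?thesis
    using \<eta> by auto
qed

private abbreviation lone :: "nat \<Rightarrow> bool" where
  "lone i \<equiv> T i \<le> s \<and> f (zs i) = f x \<and> (\<forall>j\<in>{..<m} - {i}. T j > t)
    \<and> (\<Sum>j\<in>{..<m} - {i}. far_weight r t (T j)) < s powr (- r)"

text \<open>A near sample that is not alone is disturbed either by one sample within
  \<open>t\<close>, which makes one \<open>?K j\<close> at least 1, or by the far weights jointly,
  handled by Markov's inequality. The products \<open>H * ?K j\<close> involve two different
  samples, so their expectations factor.\<close>

lemma lone_lower:
  fixes i :: nat
  defines "H \<equiv> (if T i \<le> s \<and> f (zs i) = f x then 1 else 0 :: ennreal)"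
  shows "H \<le> (if lone i then 1 else 0)
    + (\<Sum>j\<in>{..<m} - {i}. H * ((if T j \<le> t then 1 else 0) + ennreal (s powr r * far_weight r t (T j))))"
    (is "_ \<le> _ + (\<Sum>j\<in>_. H * ?K j)")
proof (cases "T i \<le> s \<and> f (zs i) = f x \<and> \<not> lone i")
  case True
  then consider j where "j \<in> {..<m} - {i}" "T j \<le> t"
    | "(\<Sum>j\<in>{..<m} - {i}. far_weight r t (T j)) \<ge> s powr (- r)"
    by (meson not_le)
  then have "1 \<le> (\<Sum>j\<in>{..<m} - {i}. ?K j)"
  proof cases
    case 1
    then have "(\<Sum>j\<in>{j}. ?K j) \<le> (\<Sum>j\<in>{..<m} - {i}. ?K j)"
      by (intro sum_mono2) auto
    moreover have "1 \<le> ?K j"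
      using 1 by simp
    ultimately show ?thesis
      by simp
  next
    case 2
    \<comment> \<open>Markov's inequality in pointwise form: the sum reaches
      \<open>s powr (- r)\<close>, so its multiple by \<open>s powr r\<close> reaches 1.\<close>
    have "1 = s powr r * s powr (- r)"
      using st by (simp add: powr_minus)
    also have "\<dots> \<le> s powr r * (\<Sum>j\<in>{..<m} - {i}. far_weight r t (T j))"
      using 2 by (intro mult_left_mono) auto
    finally have "1 \<le> ennreal (\<Sum>j\<in>{..<m} - {i}. s powr r * far_weight r t (T j))"
      by (metis ennreal_1 ennreal_leI sum_distrib_left)
    also have "\<dots> = (\<Sum>j\<in>{..<m} - {i}. ennreal (s powr r * far_weight r t (T j)))"
      by (simp add: sum_ennreal)
    also have "\<dots> \<le> (\<Sum>j\<in>{..<m} - {i}. ?K j)"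
      by (intro sum_mono) simp
    finally show ?thesis .
  qed
  then show ?thesis
    using True by (simp add: H_def)
qed (auto simp: H_def)

section \<open>Averaging over the label flips, with the sample points still fixed\<close>

context
  fixes p :: real
  assumes p: "0 \<le> p" "p \<le> 1"
begin

private abbreviation cond_err :: ennreal where
  "cond_err \<equiv> \<Sum>F\<in>Pow {..<m}. ennreal (flip_weight p m F) * (if err F then 1 else 0)"

private lemma ennreal_sum_flip_weight: "(\<Sum>F\<in>Pow {..<m}. ennreal (flip_weight p m F)) = 1"
  using p by (simp add: sum_ennreal flip_weight_nonneg sum_flip_weight)

private lemma ennreal_sum_flip_weight_mem:
  assumes "i < m"
  shows "(\<Sum>F\<in>Pow {..<m}. ennreal (flip_weight p m F) * (if i \<in> F then 1 else 0)) = ennreal p"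
proof -
  have "(\<Sum>F\<in>Pow {..<m}. ennreal (flip_weight p m F) * (if i \<in> F then 1 else 0))
      = (\<Sum>F\<in>Pow {..<m}. ennreal (flip_weight p m F * (if i \<in> F then 1 else 0)))"
    by (intro sum.cong) auto
  also have "\<dots> = ennreal (\<Sum>F\<in>Pow {..<m}. flip_weight p m F * (if i \<in> F then 1 else 0))"
    using p by (intro sum_ennreal) (simp add: flip_weight_nonneg)
  finally show ?thesis
    by (simp only: sum_flip_weight_mem[OF assms])
qed

text \<open>A union bound over the ways in which the hypotheses of \<open>NW_correct\<close> can
  fail. The indicator of a large far sum is replaced by an exponential, which factors over the
  samples and can be integrated by independence.\<close>

lemma cond_err_upper:
  assumes lam: "lam \<ge> 0"
  shows "cond_err \<le> (\<Prod>i<m. if T i > s then 1 else 0)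
    + (\<Sum>i<m. ennreal p * (if T i \<le> t then 1 else 0))
    + (\<Sum>i<m. if T i \<le> t \<and> f (zs i) \<noteq> f x then 1 else 0)
    + ennreal (exp (- (lam * s powr (- r)))) * (\<Prod>i<m. ennreal (exp (lam * far_weight r t (T i))))"
    (is "_ \<le> ?A + ?B + ?C + ?D")
proof -
  have D: "?D = ennreal (exp (lam * ((\<Sum>i<m. far_weight r t (T i)) - s powr (- r))))"
    by (simp add: prod_ennreal exp_sum[symmetric] sum_distrib_left[symmetric] ennreal_mult[symmetric]
        right_diff_distrib exp_diff exp_minus field_simps)
  have F: "(if err F then 1 else 0) \<le> ?A + (\<Sum>i<m. (if i \<in> F then 1 else 0) * (if T i \<le> t then 1 else 0))
      + ?C + ?D" (is "_ \<le> ?A + ?B' + _ + _") for F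
  proof (cases "err F")
    case True
    consider "\<forall>i<m. T i > s"
      | j where "j < m" "T j \<le> t" "j \<in> F" | j where "j < m" "T j \<le> t" "f (zs j) \<noteq> f x"
      | "(\<Sum>j<m. far_weight r t (T j)) \<ge> s powr (- r)"
      using NW_correct[of _ F] True by (meson not_le)
    then have "1 \<le> ?A \<or> 1 \<le> ?B' \<or> 1 \<le> ?C \<or> 1 \<le> ?D"
    proof cases
      case 2
      then have "(\<Sum>i\<in>{j}. (if i \<in> F then 1 else 0) * (if T i \<le> t then 1 else 0)) \<le> ?B'"
        by (intro sum_mono2) auto
      then show ?thesis using 2 by simp
    next
      case 3
      then have "(\<Sum>i\<in>{j}. if T i \<le> t \<and> f (zs i) \<noteq> f x then 1 else 0) \<le> ?C"
        by (intro sum_mono2) auto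
      then show ?thesis using 3 by simp
    next
      case 4
      then have "1 \<le> exp (lam * ((\<Sum>i<m. far_weight r t (T i)) - s powr (- r)))"
        using lam by simp
      then show ?thesis unfolding D by (metis ennreal_1 ennreal_leI)
    qed simp
    then have "1 \<le> ?A + ?B' + ?C + ?D"
      by (elim disjE; meson add_increasing add_increasing2 zero_le)
    then show ?thesis by simp
  qed simp
  have "cond_err \<le> (\<Sum>F\<in>Pow {..<m}. ennreal (flip_weight p m F) *
      (?A + (\<Sum>i<m. (if i \<in> F then 1 else 0) * (if T i \<le> t then 1 else 0)) + ?C + ?D))"
    by (intro sum_mono mult_left_mono F) auto
  \<comment> \<open>Only \<open>?B'\<close> depends on the flip set. The other terms meet the total
    mass 1, while \<open>?B'\<close> turns into the marginal probability p.\<close>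
  also have "\<dots> = (\<Sum>F\<in>Pow {..<m}. ennreal (flip_weight p m F) * (?A + ?C + ?D))
      + (\<Sum>F\<in>Pow {..<m}. \<Sum>i<m. ennreal (flip_weight p m F) * (if i \<in> F then 1 else 0)
          * (if T i \<le> t then 1 else 0))"
    by (subst sum.distrib[symmetric], intro sum.cong refl)
      (simp add: sum_distrib_left distrib_left mult.assoc add_ac)
  also have "(\<Sum>F\<in>Pow {..<m}. ennreal (flip_weight p m F) * (?A + ?C + ?D)) = ?A + ?C + ?D"
    by (simp add: sum_distrib_right[symmetric] ennreal_sum_flip_weight)
  also have "(\<Sum>F\<in>Pow {..<m}. \<Sum>i<m. ennreal (flip_weight p m F) * (if i \<in> F then 1 else 0)
          * (if T i \<le> t then 1 else 0)) = ?B"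
    by (subst sum.swap, intro sum.cong refl, subst sum_distrib_right[symmetric])
      (simp add: ennreal_sum_flip_weight_mem)
  finally show ?thesis by (simp add: add_ac)
qed

text \<open>Two samples cannot both be \<open>lone\<close>, because each would lie within s \<le> t
  of the test point. Hence the indicators of the error events for different \<open>i\<close> add up
  to at most 1.\<close>

lemma cond_err_lower:
  "(\<Sum>i<m. ennreal p * (if lone i then 1 else 0)) \<le> cond_err"
proof -
  have F: "(\<Sum>i<m. (if i \<in> F then 1 else 0) * (if lone i then 1 else 0)) \<le> (if err F then 1 else (0::ennreal))" for F
  proof (cases "\<exists>i<m. i \<in> F \<and> lone i")
    case True
    then obtain i where i: "i < m" "i \<in> F" "lone i" by blast
    have "\<not> lone j" if "j \<in> {..<m} - {i}" for j
    proof -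
      have "T j > t" using i that by blast
      then show ?thesis using st by simp
    qed
    then have "(\<Sum>j\<in>{..<m} - {i}. (if j \<in> F then 1 else 0) * (if lone j then 1 else (0::ennreal))) = 0"
      by (intro sum.neutral) auto
    then have "(\<Sum>i<m. (if i \<in> F then 1 else 0) * (if lone i then 1 else (0::ennreal))) = 1"
      using i by (simp add: sum.remove[of "{..<m}" i])
    moreover have "err F"
      using NW_wrong[of i F] i by auto
    ultimately show ?thesis by simp
  next
    case False
    then have "(\<Sum>i<m. (if i \<in> F then 1 else 0) * (if lone i then 1 else (0::ennreal))) = 0"
      by (intro sum.neutral) auto
    then show ?thesis by (simp only: zero_le)
  qed
  have "(\<Sum>i<m. ennreal p * (if lone i then 1 else 0))
      = (\<Sum>i<m. (\<Sum>F\<in>Pow {..<m}. ennreal (flip_weight p m F) * (if i \<in> F then 1 else 0)) * (if lone i then 1 else 0))"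
    by (intro sum.cong refl) (simp only: ennreal_sum_flip_weight_mem lessThan_iff)
  also have "\<dots> = (\<Sum>F\<in>Pow {..<m}. ennreal (flip_weight p m F) *
      (\<Sum>i<m. (if i \<in> F then 1 else 0) * (if lone i then 1 else 0)))"
    unfolding sum_distrib_right by (subst sum.swap) (simp only: sum_distrib_left mult.assoc)
  also have "\<dots> \<le> cond_err"
    by (intro sum_mono mult_left_mono F) auto
  finally show ?thesis .
qed

end

end

subsection \<open>Independent samples\<close>

lemma prod_pair_const:
  fixes h k :: "'a \<Rightarrow> 'b :: comm_monoid_mult"
  assumes "finite I" "i \<in> I" "j \<in> I" "i \<noteq> j"
  shows "(\<Prod>l\<in>I. (if l = i then h else if l = j then k else (\<lambda>_. 1)) (z l)) = h (z i) * k (z j)"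
proof -
  have "(\<Prod>l\<in>I. (if l = i then h else if l = j then k else (\<lambda>_. 1)) (z l))
      = (\<Prod>l\<in>{i, j}. (if l = i then h else if l = j then k else (\<lambda>_. 1)) (z l))"
    using assms by (intro prod.mono_neutral_right) auto
  then show ?thesis
    using assms by simp
qed

locale iid_sample = prob_space M for M :: "'a measure"
begin

lemma total_mass: "emeasure M (space M) = 1"
  by (rule emeasure_space_1)

lemma prob_space_M: "prob_space M"
  by unfold_locales

sublocale product_prob_space "\<lambda>_::nat. M"
  by unfold_locales

lemma nn_integral_sample_component:
  assumes "i \<in> I" and [measurable]: "h \<in> borel_measurable M"
  shows "(\<integral>\<^sup>+zs. h (zs i) \<partial>PiM I (\<lambda>_. M)) = (\<integral>\<^sup>+z. h z \<partial>M)"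
proof -
  have "(\<integral>\<^sup>+z. h z \<partial>M) = (\<integral>\<^sup>+z. h z \<partial>distr (PiM I (\<lambda>_. M)) M (\<lambda>zs. zs i))"
    using PiM_component[OF assms(1)] by simp
  also have "\<dots> = (\<integral>\<^sup>+zs. h (zs i) \<partial>PiM I (\<lambda>_. M))"
    using assms(1) by (intro nn_integral_distr) auto
  finally show ?thesis by simp
qed

lemma nn_integral_sample_pair:
  assumes "finite I" "i \<in> I" "j \<in> I" "i \<noteq> j"
    and [measurable]: "h \<in> borel_measurable M" "k \<in> borel_measurable M"
  shows "(\<integral>\<^sup>+zs. h (zs i) * k (zs j) \<partial>PiM I (\<lambda>_. M)) = (\<integral>\<^sup>+z. h z \<partial>M) * (\<integral>\<^sup>+z. k z \<partial>M)"
proof -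
  let ?g = "\<lambda>l. if l = i then h else if l = j then k else (\<lambda>_. 1)"
  have "(\<integral>\<^sup>+zs. h (zs i) * k (zs j) \<partial>PiM I (\<lambda>_. M)) = (\<integral>\<^sup>+zs. (\<Prod>l\<in>I. ?g l (zs l)) \<partial>PiM I (\<lambda>_. M))"
    by (simp only: prod_pair_const[OF assms(1-4)])
  also have "\<dots> = (\<Prod>l\<in>I. integral\<^sup>N M (?g l))"
    by (intro product_nn_integral_prod assms(1)) auto
  also have "\<dots> = (\<Prod>l\<in>{i, j}. integral\<^sup>N M (?g l))"
    using assms(1-4) by (intro prod.mono_neutral_right) (auto simp: total_mass)
  finally show ?thesis
    using assms(4) by simp
qed

lemma nn_integral_sample_prod:
  assumes "h \<in> borel_measurable M"
  shows "(\<integral>\<^sup>+zs. (\<Prod>i<m. h (zs i)) \<partial>PiM {..<m} (\<lambda>_. M)) = (\<integral>\<^sup>+z. h z \<partial>M) ^ m"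
  using product_nn_integral_prod[of "{..<m}" "\<lambda>_. h"] assms by simp

text \<open>Fubini for index \<open>m\<close>, which carries the test point. The second part
  supplies the measurability in \<open>x\<close> that Fatou's lemma asks for later.\<close>

lemma nn_integral_sample_test_point:
  fixes m :: nat
  assumes [measurable]: "g \<in> borel_measurable (PiM {..m} (\<lambda>_. M))"
  shows "(\<integral>\<^sup>+zs. g zs \<partial>PiM {..m} (\<lambda>_. M)) = (\<integral>\<^sup>+x. \<integral>\<^sup>+zs. g (zs(m := x)) \<partial>PiM {..<m} (\<lambda>_. M) \<partial>M)"
    and "(\<lambda>x. \<integral>\<^sup>+zs. g (zs(m := x)) \<partial>PiM {..<m} (\<lambda>_. M)) \<in> borel_measurable M"
proof -
  have I: "{..m} = insert m {..<m}"
    by auto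
  have g: "g \<in> borel_measurable (PiM (insert m {..<m}) (\<lambda>_. M))"
    using assms unfolding I .
  show "(\<integral>\<^sup>+zs. g zs \<partial>PiM {..m} (\<lambda>_. M)) = (\<integral>\<^sup>+x. \<integral>\<^sup>+zs. g (zs(m := x)) \<partial>PiM {..<m} (\<lambda>_. M) \<partial>M)"
    unfolding I by (rule product_nn_integral_insert_rev) (use g in auto)
  interpret S: prob_space "PiM {..<m} (\<lambda>_. M)"
    by (intro prob_space_PiM prob_space_M)
  have "(\<lambda>(x, zs). zs(m := x)) \<in> M \<Otimes>\<^sub>M PiM {..<m} (\<lambda>_. M) \<rightarrow>\<^sub>M PiM (insert m {..<m}) (\<lambda>_. M)"
    using measurable_compose[OF measurable_pair_swap' measurable_add_dim]
    by (simp add: case_prod_beta)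
  from measurable_compose[OF this g]
  show "(\<lambda>x. \<integral>\<^sup>+zs. g (zs(m := x)) \<partial>PiM {..<m} (\<lambda>_. M)) \<in> borel_measurable M"
    by (intro S.borel_measurable_nn_integral) (simp add: case_prod_beta)
qed

end

text \<open>The set where T is at most u is a ball of Lebesgue measure u/\<mu>(x). On small balls
  continuity keeps the density between half and twice \<mu>(x), so the mass is between u/2 and
  2u.\<close>

lemma radial_scale_vol_scale:
  fixes d :: nat and f \<mu> :: "(nat \<Rightarrow> real) \<Rightarrow> real"
  defines "M \<equiv> density (Leb_d d) (\<lambda>x. ennreal (\<mu> x))"
  assumes d: "d \<ge> 1" and \<beta>: "\<beta> > real d" and \<mu>: "prob_density_d d \<mu>"
    and x: "x \<in> space (Leb_d d)" "\<mu> x > 0" "cont_at_d d \<mu> x" "locally_const_at_d d f x"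
  obtains u0 where
    "radial_scale M (vol_scale d (unit_ball_vol (real d) * \<mu> x) x) (\<beta> / real d) u0"
    "\<And>z. z \<in> space (Leb_d d) \<Longrightarrow> vol_scale d (unit_ball_vol (real d) * \<mu> x) x z \<le> u0 \<Longrightarrow> f z = f x"
proof -
  let ?L = "Leb_d d"
  define V where "V = unit_ball_vol (real d)"
  define \<kappa> where "\<kappa> = V * \<mu> x"
  have V: "V > 0"
    by (simp add: V_def)
  then have \<kappa>: "\<kappa> > 0"
    using x by (simp add: \<kappa>_def)
  have [measurable]: "\<mu> \<in> borel_measurable ?L" and \<mu>_nonneg: "\<And>z. z \<in> space ?L \<Longrightarrow> \<mu> z \<ge> 0"
    and \<mu>_1: "(\<integral>\<^sup>+z. ennreal (\<mu> z) \<partial>?L) = 1"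
    using \<mu> by (auto simp: prob_density_d_def)
  have "\<mu> x / 2 > 0"
    using x by simp
  then obtain \<delta>1 where \<delta>1: "\<delta>1 > 0" "\<And>y. y \<in> space ?L \<Longrightarrow> dist_d d x y < \<delta>1 \<Longrightarrow> \<bar>\<mu> y - \<mu> x\<bar> < \<mu> x / 2"
    using x(3) unfolding cont_at_d_def by meson
  obtain \<delta>2 where \<delta>2: "\<delta>2 > 0" "\<And>y. y \<in> space ?L \<Longrightarrow> dist_d d x y < \<delta>2 \<Longrightarrow> f y = f x"
    using x(4) unfolding locally_const_at_d_def by meson
  \<comment> \<open>Halving puts the closed ball of radius \<delta> inside both open
    neighbourhoods.\<close>
  define \<delta> where "\<delta> = min \<delta>1 \<delta>2 / 2"
  have \<delta>: "0 < \<delta>" "\<delta> < \<delta>1" "\<delta> < \<delta>2"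
    using \<delta>1 \<delta>2 by (auto simp: \<delta>_def)
  define u0 where "u0 = \<kappa> * \<delta> ^ d"
  have u0: "u0 > 0"
    using \<kappa> \<delta> by (simp add: u0_def)
  let ?T = "vol_scale d \<kappa> x"
  have T_le_iff: "?T z \<le> \<kappa> * \<rho> ^ d \<longleftrightarrow> dist_d d x z \<le> \<rho>" if "\<rho> \<ge> 0" for \<rho> z
    using \<kappa> d that dist_d_nonneg[of d x z] power_mono_iff[of "dist_d d x z" \<rho> d]
    by (simp add: vol_scale_def)
  have [measurable]: "?T \<in> borel_measurable ?L"
    using x(1) unfolding vol_scale_def by measurable
  have sM: "space M = space ?L" "sets M = sets ?L"
    by (simp_all add: M_def)
  interpret prob_space "M"
    by standard (simp add: M_def emeasure_density \<mu>_1 cong: nn_integral_cong)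
  have cdf: "u / 2 \<le> prob {z \<in> space M. ?T z \<le> u} \<and> prob {z \<in> space M. ?T z \<le> u} \<le> 2 * u"
    if u: "0 < u" "u \<le> u0" for u
  proof -
    define \<rho> where "\<rho> = root d (u / \<kappa>)"
    have \<rho>: "\<rho> > 0" "\<rho> ^ d = u / \<kappa>"
      using d u \<kappa> by (auto simp: \<rho>_def real_root_gt_zero)
    have "\<rho> ^ d \<le> \<delta> ^ d"
      unfolding \<rho> using u \<kappa> by (simp add: u0_def field_simps)
    then have "\<rho> \<le> \<delta>"
      using power_mono_iff[of \<rho> \<delta> d] \<rho>(1) \<delta> d by simp
    let ?B = "{z \<in> space ?L. dist_d d x z \<le> \<rho>}"
    have B: "{z \<in> space M. ?T z \<le> u} = ?B"
      using T_le_iff[of \<rho>] \<rho> \<kappa> by (auto simp: sM)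
    have Bm: "?B \<in> sets ?L"
      using x(1) by measurable
    have LB: "emeasure ?L ?B = ennreal (V * (u / \<kappa>))"
      using emeasure_Leb_d_cball[OF \<rho>(1), of d x] by (simp add: V_def \<rho>(2))
    have near: "\<mu> x \<le> \<mu> z * 2" "\<mu> z \<le> 2 * \<mu> x" if "z \<in> ?B" for z
    proof -
      have "\<bar>\<mu> z - \<mu> x\<bar> < \<mu> x / 2"
        using \<delta>1(2)[of z] that \<delta> \<open>\<rho> \<le> \<delta>\<close> by simp
      then show "\<mu> x \<le> \<mu> z * 2" "\<mu> z \<le> 2 * \<mu> x"
        using x(2) by linarith+
    qed
    have em: "emeasure M ?B = (\<integral>\<^sup>+z. ennreal (\<mu> z) * indicator ?B z \<partial>?L)"
      unfolding M_def using Bm by (intro emeasure_density) auto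
    have int_const: "(\<integral>\<^sup>+z. ennreal c * indicator ?B z \<partial>?L) = ennreal (c * (V * (u / \<kappa>)))" if "c \<ge> 0" for c
      using Bm that by (simp add: nn_integral_cmult LB ennreal_mult'[symmetric])
    have VU: "\<mu> x / 2 * (V * (u / \<kappa>)) = u / 2" "2 * \<mu> x * (V * (u / \<kappa>)) = 2 * u"
      using V x by (simp_all add: \<kappa>_def)
    have "ennreal (\<mu> x / 2 * (V * (u / \<kappa>))) \<le> emeasure M ?B"
      unfolding em int_const[symmetric, of "\<mu> x / 2", OF less_imp_le[OF \<open>\<mu> x / 2 > 0\<close>]]
      by (intro nn_integral_mono) (auto simp: indicator_def near intro!: ennreal_leI)
    moreover have "emeasure M ?B \<le> ennreal (2 * \<mu> x * (V * (u / \<kappa>)))"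
      unfolding em using x(2)
      by (subst int_const[symmetric]) (auto intro!: nn_integral_mono ennreal_leI simp: indicator_def near)
    ultimately show ?thesis
      unfolding B VU using u by (simp add: emeasure_eq_measure)
  qed
  show ?thesis
  proof (rule that)
    show "radial_scale M (vol_scale d (unit_ball_vol (real d) * \<mu> x) x) (\<beta> / real d) u0"
      unfolding V_def[symmetric] \<kappa>_def[symmetric]
    proof
      show "?T \<in> borel_measurable M"
        by (simp add: M_def)
      show "1 < \<beta> / real d"
        using d \<beta> by simp
    qed (use u0 cdf in auto)
    show "f z = f x" if "z \<in> space ?L" "vol_scale d (unit_ball_vol (real d) * \<mu> x) x z \<le> u0" for z
      using \<delta>2(2)[of z] that T_le_iff[of \<delta> z] \<delta>
      unfolding V_def[symmetric] \<kappa>_def[symmetric] u0_def by auto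
  qed
qed

subsection \<open>The error at a fixed test point\<close>

text \<open>The exponent 1/(r-1) is positive, and the base is at least 1 because 2^r grows at least
  linearly: 2^r \<ge> 1 + r ln 2 with ln 2 \<ge> 2/3.\<close>

lemma c_exp_ge_1:
  assumes "r > 1"
  shows "c_exp r \<ge> 1"
proof -
  have "2 powr r = exp (r * ln 2)"
    by (simp add: powr_def)
  also have "\<dots> \<ge> 1 + r * ln 2"
    by (rule exp_ge_add_one_self)
  finally have "2 powr r \<ge> 1 + r * ln 2" .
  moreover have "r * ln 2 \<ge> r * (2 / 3)"
    using assms ln2_ge_two_thirds by (intro mult_left_mono) auto
  ultimately have "8 * 2 powr r \<ge> r - 1"
    using assms by linarith
  then have "8 * 2 powr r / (r - 1) \<ge> 1"
    using assms by simp
  then show ?thesis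
    using assms by (simp add: c_exp_def ge_one_powr_ge_zero)
qed

text \<open>The solution a of a^r * tail_const r * (1/8)^(1-r) = 1/8, as required in
  \<open>lower_estimate\<close>.\<close>

definition near_radius :: "real \<Rightarrow> real" where
  "near_radius r = (1 / (tail_const r * 8 powr r)) powr (1 / r)"

text \<open>The bound 1/8 places the near ball inside the ball that has to be free of other
  samples.\<close>

lemma near_radius_bounds:
  assumes "r > 1"
  shows "0 < near_radius r" "near_radius r \<le> 1 / 8"
proof -
  have C: "tail_const r \<ge> 4"
    by (rule tail_const_ge[OF assms])
  then show "0 < near_radius r"
    by (simp add: near_radius_def)
  have "near_radius r \<le> (1 / 8 powr r) powr (1 / r)"
    unfolding near_radius_def using C assms by (intro powr_mono2) (auto simp: field_simps)
  also have "\<dots> = 1 / 8"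
    using assms by (simp add: powr_divide powr_powr)
  finally show "near_radius r \<le> 1 / 8" .
qed

section \<open>The setting of the theorem, with \<open>M\<close> the law of a single point\<close>

locale NW_setup =
  fixes d :: nat and \<beta> :: real and f \<mu> :: "(nat \<Rightarrow> real) \<Rightarrow> real"
  assumes d: "d \<ge> 1" and \<beta>: "\<beta> > real d" and \<mu>: "prob_density_d d \<mu>"
    and f: "\<forall>x\<in>space (Leb_d d). f x \<in> {-1, 1}"
    and \<mu>_cont: "AE x in Leb_d d. cont_at_d d \<mu> x"
    and f_const: "AE x in Leb_d d. locally_const_at_d d f x"
begin

definition r :: real where "r = \<beta> / real d"

definition M :: "(nat \<Rightarrow> real) measure" where
  "M = density (Leb_d d) (\<lambda>x. ennreal (\<mu> x))"

lemma r_gt_1: "r > 1"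
  using d \<beta> by (simp add: r_def)

lemma space_M [simp]: "space M = space (Leb_d d)" and sets_M [simp, measurable_cong]: "sets M = sets (Leb_d d)"
  by (simp_all add: M_def)

lemma \<mu>_measurable [measurable]: "\<mu> \<in> borel_measurable (Leb_d d)"
  using \<mu> by (simp add: prob_density_d_def)

lemma f_measurable [measurable]: "f \<in> borel_measurable (Leb_d d)"
  by (rule measurable_locally_const[OF f f_const])

sublocale iid_sample M
proof (intro iid_sample.intro prob_spaceI)
  show "emeasure M (space M) = 1"
    using \<mu> by (simp add: M_def prob_density_d_def emeasure_density cong: nn_integral_cong)
qed

definition scale :: "(nat \<Rightarrow> real) \<Rightarrow> (nat \<Rightarrow> real) \<Rightarrow> real" where
  "scale x = vol_scale d (unit_ball_vol (real d) * \<mu> x) x"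

definition good :: "(nat \<Rightarrow> real) \<Rightarrow> bool" where
  "good x \<longleftrightarrow> x \<in> space (Leb_d d) \<and> \<mu> x > 0 \<and> cont_at_d d \<mu> x \<and> locally_const_at_d d f x"

text \<open>Regularity holds Lebesgue-almost everywhere, and points of density 0 form a null set for
  \<open>M\<close>.\<close>

lemma AE_good: "AE x in M. good x"
proof -
  have "AE x in Leb_d d. 0 < ennreal (\<mu> x) \<longrightarrow> good x"
    using \<mu>_cont f_const AE_space by eventually_elim (simp add: good_def)
  then show ?thesis
    unfolding M_def by (subst AE_density) auto
qed

lemma good_scale:
  assumes "good x"
  obtains u0 where "radial_scale M (scale x) r u0"
    "\<And>z. z \<in> space (Leb_d d) \<Longrightarrow> scale x z \<le> u0 \<Longrightarrow> f z = f x"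
  using radial_scale_vol_scale[OF d \<beta> \<mu>] assms
  unfolding good_def scale_def M_def r_def by metis

text \<open>For large m the radius c/m drops below \<open>u0\<close>, so differing true labels near
  the test point disappear entirely from the bounds.\<close>

lemma good_f_const_eventually:
  assumes "good x"
  shows "eventually (\<lambda>m. \<forall>z\<in>space (Leb_d d). scale x z \<le> c / real m \<longrightarrow> f z = f x) sequentially"
proof -
  obtain u0 where u0: "radial_scale M (scale x) r u0"
    "\<And>z. z \<in> space (Leb_d d) \<Longrightarrow> scale x z \<le> u0 \<Longrightarrow> f z = f x"
    using good_scale[OF assms] by blast
  have "eventually (\<lambda>m. c / real m < u0) sequentially"
    using radial_scale.u0[OF u0(1)] by (intro order_tendstoD(2)[OF lim_const_over_n]) auto
  then show ?thesis
    by eventually_elim (use u0(2) in force)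
qed

definition cond_err :: "real \<Rightarrow> nat \<Rightarrow> (nat \<Rightarrow> nat \<Rightarrow> real) \<Rightarrow> ennreal" where
  "cond_err p m zs = (\<Sum>F\<in>Pow {..<m}. ennreal (flip_weight p m F) *
     (if NW_interp d \<beta> m zs (\<lambda>i. if i \<in> F then - f (zs i) else f (zs i)) (zs m) \<noteq> f (zs m)
      then 1 else 0))"

text \<open>Completing a measure does not change its nonnegative integrals, even for an integrand
  not known to be measurable.\<close>

lemma exp_clean_error_eq:
  "exp_clean_error d \<beta> \<mu> f p m = (\<integral>\<^sup>+zs. cond_err p m zs \<partial>PiM {..m} (\<lambda>_. M))"
  by (simp add: exp_clean_error_def nn_integral_completion cond_err_def flip_weight_def M_def)

lemma scale_measurable [measurable]:
  assumes [measurable]: "g \<in> measurable N (Leb_d d)" "h \<in> measurable N (Leb_d d)"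
  shows "(\<lambda>w. scale (g w) (h w)) \<in> borel_measurable N"
  unfolding scale_def vol_scale_def by measurable

lemma sample_measurable:
  "i \<in> I \<Longrightarrow> (\<lambda>zs. zs i) \<in> measurable (PiM I (\<lambda>_::nat. M)) (Leb_d d)"
  using measurable_component_singleton[of i I "\<lambda>_. M"] by (simp cong: measurable_cong_sets)

lemma sample_space:
  "zs \<in> space (PiM I (\<lambda>_::nat. M)) \<Longrightarrow> i \<in> I \<Longrightarrow> zs i \<in> space (Leb_d d)"
  by (auto simp: space_PiM)

text \<open>The measurable majorant from \<open>cond_err_upper\<close>. The test point is a separate
  argument so that it can be frozen after Fubini; \<open>lower_fun\<close> follows the same
  pattern.\<close>

definition upper_fun :: "real \<Rightarrow> nat \<Rightarrow> real \<Rightarrow> real \<Rightarrow> real \<Rightarrow> (nat \<Rightarrow> real) \<Rightarrow> (nat \<Rightarrow> nat \<Rightarrow> real) \<Rightarrow> ennreal" where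
  "upper_fun p m s t lam x zs = (\<Prod>i<m. if scale x (zs i) > s then 1 else 0)
    + (\<Sum>i<m. ennreal p * (if scale x (zs i) \<le> t then 1 else 0))
    + (\<Sum>i<m. if scale x (zs i) \<le> t \<and> f (zs i) \<noteq> f x then 1 else 0)
    + ennreal (exp (- (lam * s powr (- r)))) * (\<Prod>i<m. ennreal (exp (lam * far_weight r t (scale x (zs i)))))"

definition lone :: "nat \<Rightarrow> real \<Rightarrow> real \<Rightarrow> (nat \<Rightarrow> real) \<Rightarrow> (nat \<Rightarrow> nat \<Rightarrow> real) \<Rightarrow> nat \<Rightarrow> bool" where
  "lone m s t x zs i \<longleftrightarrow> scale x (zs i) \<le> s \<and> f (zs i) = f x \<and> (\<forall>j\<in>{..<m} - {i}. scale x (zs j) > t)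
    \<and> (\<Sum>j\<in>{..<m} - {i}. far_weight r t (scale x (zs j))) < s powr (- r)"

definition lower_fun :: "nat \<Rightarrow> real \<Rightarrow> real \<Rightarrow> (nat \<Rightarrow> real) \<Rightarrow> (nat \<Rightarrow> nat \<Rightarrow> real) \<Rightarrow> ennreal" where
  "lower_fun m s t x zs = (\<Sum>i<m. if lone m s t x zs i then 1 else 0)"

lemma upper_fun_measurable [measurable]:
  assumes [measurable]: "\<And>i. i < m \<Longrightarrow> (\<lambda>w. zs w i) \<in> measurable N (Leb_d d)" "x \<in> measurable N (Leb_d d)"
  shows "(\<lambda>w. upper_fun p m s t lam (x w) (zs w)) \<in> borel_measurable N"
  unfolding upper_fun_def by measurable

lemma lower_fun_measurable [measurable]:
  assumes [measurable]: "\<And>i. i < m \<Longrightarrow> (\<lambda>w. zs w i) \<in> measurable N (Leb_d d)" "x \<in> measurable N (Leb_d d)"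
  shows "(\<lambda>w. lower_fun m s t (x w) (zs w)) \<in> borel_measurable N"
  unfolding lower_fun_def lone_def by measurable

lemma f_measurable_M: "f \<in> borel_measurable M"
  using f_measurable by (simp cong: measurable_cong_sets)

lemma scale_measurable_M: "x \<in> space (Leb_d d) \<Longrightarrow> scale x \<in> borel_measurable M"
  using scale_measurable[of "\<lambda>_. x" M "\<lambda>z. z"] by (simp add: measurable_ident_sets)

lemma unit_ball_scale_pos: "\<mu> x > 0 \<Longrightarrow> unit_ball_vol (real d) * \<mu> x > 0"
  by simp

lemma cond_err_le_upper_fun:
  assumes zs: "zs \<in> space (PiM {..m} (\<lambda>_. M))" and \<mu>: "\<mu> (zs m) > 0"
    and st: "0 < s" "s \<le> t" and p: "0 \<le> p" "p \<le> 1" and lam: "lam \<ge> 0"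
  shows "cond_err p m zs \<le> upper_fun p m s t lam (zs m) zs"
  unfolding cond_err_def upper_fun_def
  by (rule cond_err_upper[OF d \<beta> r_def unit_ball_scale_pos[OF \<mu>] f _ _ _ st p lam])
    (use zs in \<open>auto simp: scale_def sample_space\<close>)

lemma cond_err_le_one:
  assumes "0 \<le> p" "p \<le> 1"
  shows "cond_err p m zs \<le> 1"
proof -
  have "cond_err p m zs \<le> (\<Sum>F\<in>Pow {..<m}. ennreal (flip_weight p m F) * 1)"
    unfolding cond_err_def by (intro sum_mono mult_left_mono) auto
  also have "\<dots> = 1"
    using assms by (simp add: sum_ennreal flip_weight_nonneg sum_flip_weight)
  finally show ?thesis .
qed

lemma lower_fun_le_cond_err:
  assumes zs: "zs \<in> space (PiM {..m} (\<lambda>_. M))" and \<mu>: "\<mu> (zs m) > 0"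
    and st: "0 < s" "s \<le> t" and p: "0 \<le> p" "p \<le> 1"
  shows "ennreal p * lower_fun m s t (zs m) zs \<le> cond_err p m zs"
  unfolding cond_err_def lower_fun_def lone_def sum_distrib_left
  by (rule cond_err_lower[OF d \<beta> r_def unit_ball_scale_pos[OF \<mu>] f _ _ _ st p])
    (use zs in \<open>auto simp: scale_def sample_space\<close>)

lemma nn_integral_upper_fun:
  assumes x: "x \<in> space (Leb_d d)"
  shows "(\<integral>\<^sup>+zs. upper_fun p m s t lam x zs \<partial>PiM {..<m} (\<lambda>_. M))
    = (\<integral>\<^sup>+z. (if scale x z > s then 1 else 0) \<partial>M) ^ m
    + of_nat m * (ennreal p * (\<integral>\<^sup>+z. (if scale x z \<le> t then 1 else 0) \<partial>M))
    + of_nat m * (\<integral>\<^sup>+z. (if scale x z \<le> t \<and> f z \<noteq> f x then 1 else 0) \<partial>M)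
    + ennreal (exp (- (lam * s powr (- r)))) *
      (\<integral>\<^sup>+z. ennreal (exp (lam * far_weight r t (scale x z))) \<partial>M) ^ m"
proof -
  let ?P = "PiM {..<m} (\<lambda>_. M)"
  note [measurable] = scale_measurable_M[OF x] f_measurable_M
  have [measurable]: "(\<lambda>zs. zs i) \<in> measurable ?P M" if "i < m" for i
    using that by (intro measurable_component_singleton) auto
  have "(\<integral>\<^sup>+zs. upper_fun p m s t lam x zs \<partial>?P) =
     (\<integral>\<^sup>+zs. (\<Prod>i<m. if scale x (zs i) > s then 1 else 0) \<partial>?P)
    + (\<Sum>i<m. \<integral>\<^sup>+zs. ennreal p * (if scale x (zs i) \<le> t then 1 else 0) \<partial>?P)
    + (\<Sum>i<m. \<integral>\<^sup>+zs. (if scale x (zs i) \<le> t \<and> f (zs i) \<noteq> f x then 1 else 0) \<partial>?P)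
    + ennreal (exp (- (lam * s powr (- r)))) *
      (\<integral>\<^sup>+zs. (\<Prod>i<m. ennreal (exp (lam * far_weight r t (scale x (zs i))))) \<partial>?P)"
    unfolding upper_fun_def by (simp add: nn_integral_add nn_integral_sum nn_integral_cmult)
  also have "(\<integral>\<^sup>+zs. (\<Prod>i<m. if scale x (zs i) > s then 1 else 0) \<partial>?P)
      = (\<integral>\<^sup>+z. (if scale x z > s then 1 else 0) \<partial>M) ^ m"
    by (rule nn_integral_sample_prod) measurable
  also have "(\<Sum>i<m. \<integral>\<^sup>+zs. ennreal p * (if scale x (zs i) \<le> t then 1 else 0) \<partial>?P)
      = (\<Sum>i<m. \<integral>\<^sup>+z. ennreal p * (if scale x z \<le> t then 1 else 0) \<partial>M)"
    by (intro sum.cong refl nn_integral_sample_component) auto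
  also have "\<dots> = of_nat m * (ennreal p * (\<integral>\<^sup>+z. (if scale x z \<le> t then 1 else 0) \<partial>M))"
    by (simp add: nn_integral_cmult)
  also have "(\<Sum>i<m. \<integral>\<^sup>+zs. (if scale x (zs i) \<le> t \<and> f (zs i) \<noteq> f x then 1 else 0) \<partial>?P)
      = (\<Sum>i<m. \<integral>\<^sup>+z. (if scale x z \<le> t \<and> f z \<noteq> f x then 1 else 0) \<partial>M)"
    by (intro sum.cong refl nn_integral_sample_component) auto
  also have "\<dots> = of_nat m * (\<integral>\<^sup>+z. (if scale x z \<le> t \<and> f z \<noteq> f x then 1 else 0) \<partial>M)"
    by simp
  also have "(\<integral>\<^sup>+zs. (\<Prod>i<m. ennreal (exp (lam * far_weight r t (scale x (zs i))))) \<partial>?P)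
      = (\<integral>\<^sup>+z. ennreal (exp (lam * far_weight r t (scale x z))) \<partial>M) ^ m"
    by (rule nn_integral_sample_prod) measurable
  finally show ?thesis .
qed

text \<open>Expectation of \<open>lone_lower\<close> summed over all samples, with independence
  applied to each pair.\<close>

lemma nn_integral_lower_fun:
  assumes x: "x \<in> space (Leb_d d)" "\<mu> x > 0" and st: "0 < s" "s \<le> t"
  defines "h \<equiv> emeasure M {z \<in> space M. scale x z \<le> s \<and> f z = f x}"
  shows "of_nat m * h \<le> (\<integral>\<^sup>+zs. lower_fun m s t x zs \<partial>PiM {..<m} (\<lambda>_. M))
    + of_nat m * (of_nat m * (h * (\<integral>\<^sup>+z. (if scale x z \<le> t then 1 else 0)
        + ennreal (s powr r * far_weight r t (scale x z)) \<partial>M)))"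
proof -
  let ?P = "PiM {..<m} (\<lambda>_. M)"
  define H :: "(nat \<Rightarrow> real) \<Rightarrow> ennreal" where "H z = (if scale x z \<le> s \<and> f z = f x then 1 else 0)" for z
  define K where "K z = (if scale x z \<le> t then 1 else 0) + ennreal (s powr r * far_weight r t (scale x z))" for z
  note [measurable] = scale_measurable_M[OF x(1)] f_measurable_M
  have [measurable]: "H \<in> borel_measurable M" "K \<in> borel_measurable M"
    unfolding H_def K_def by measurable
  have [measurable]: "(\<lambda>zs. zs i) \<in> measurable ?P M" if "i < m" for i
    using that by (intro measurable_component_singleton) auto
  have [measurable]: "(\<lambda>zs. lower_fun m s t x zs) \<in> borel_measurable ?P"
    using x by (intro lower_fun_measurable sample_measurable) auto
  have h: "h = (\<integral>\<^sup>+z. H z \<partial>M)"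
    unfolding h_def H_def by (rule nn_integral_if_1_0[symmetric]) measurable
  have "of_nat m * h = (\<Sum>i<m. \<integral>\<^sup>+zs. H (zs i) \<partial>?P)"
    by (simp add: h nn_integral_sample_component)
  also have "\<dots> = (\<integral>\<^sup>+zs. (\<Sum>i<m. H (zs i)) \<partial>?P)"
    by (simp add: nn_integral_sum)
  also have "\<dots> \<le> (\<integral>\<^sup>+zs. lower_fun m s t x zs + (\<Sum>i<m. \<Sum>j\<in>{..<m} - {i}. H (zs i) * K (zs j)) \<partial>?P)"
  proof (rule nn_integral_mono)
    fix zs assume zs: "zs \<in> space ?P"
    have "H (zs i) \<le> (if lone m s t x zs i then 1 else 0) + (\<Sum>j\<in>{..<m} - {i}. H (zs i) * K (zs j))" for i
      unfolding H_def K_def lone_def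
      by (rule lone_lower[OF d \<beta> r_def unit_ball_scale_pos[OF x(2)] f _ x(1) _ st])
        (use zs in \<open>auto simp: scale_def sample_space\<close>)
    then have "(\<Sum>i<m. H (zs i)) \<le> (\<Sum>i<m. (if lone m s t x zs i then 1 else 0) + (\<Sum>j\<in>{..<m} - {i}. H (zs i) * K (zs j)))"
      by (intro sum_mono)
    then show "(\<Sum>i<m. H (zs i)) \<le> lower_fun m s t x zs + (\<Sum>i<m. \<Sum>j\<in>{..<m} - {i}. H (zs i) * K (zs j))"
      by (simp only: lower_fun_def sum.distrib)
  qed
  also have "\<dots> = (\<integral>\<^sup>+zs. lower_fun m s t x zs \<partial>?P)
      + (\<integral>\<^sup>+zs. (\<Sum>i<m. \<Sum>j\<in>{..<m} - {i}. H (zs i) * K (zs j)) \<partial>?P)"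
    by (intro nn_integral_add) measurable
  also have "(\<integral>\<^sup>+zs. (\<Sum>i<m. \<Sum>j\<in>{..<m} - {i}. H (zs i) * K (zs j)) \<partial>?P)
      = (\<Sum>i<m. \<Sum>j\<in>{..<m} - {i}. \<integral>\<^sup>+zs. H (zs i) * K (zs j) \<partial>?P)"
    by (subst nn_integral_sum; measurable; intro sum.cong refl nn_integral_sum) measurable
  also have "\<dots> = (\<Sum>i<m. \<Sum>j\<in>{..<m} - {i}. h * (\<integral>\<^sup>+z. K z \<partial>M))"
    unfolding h by (intro sum.cong refl nn_integral_sample_pair) auto
  \<comment> \<open>Adding the diagonal terms only enlarges the sum and gives the clean factor
    m^2.\<close>
  also have "\<dots> \<le> (\<Sum>i<m. \<Sum>j<m. h * (\<integral>\<^sup>+z. K z \<partial>M))"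
    by (intro sum_mono sum_mono2) auto
  also have "\<dots> = of_nat m * (of_nat m * (h * (\<integral>\<^sup>+z. K z \<partial>M)))"
    by simp
  finally show ?thesis
    by (simp add: K_def add_left_mono)
qed

lemma upper_conditional:
  assumes x: "good x" and a: "a \<ge> 1" and p: "p \<ge> 0"
    and b: "b = (8 * tail_const r) powr (1 / (r - 1)) * a powr (r / (r - 1))"
  shows "eventually (\<lambda>m. (\<integral>\<^sup>+zs. upper_fun p m (a / real m) (b / real m) (a * (a / real m) powr r) x zs
      \<partial>PiM {..<m} (\<lambda>_. M)) \<le> ennreal (2 * exp (- (a / 2)) + 2 * p * b)) sequentially"
proof -
  obtain u0 where u0: "radial_scale M (scale x) r u0"
    using good_scale[OF x] by blast
  have xs: "x \<in> space (Leb_d d)"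
    using x by (simp add: good_def)
  show ?thesis
    using radial_scale.upper_estimate[OF u0 a p b] good_f_const_eventually[OF x, of b]
      eventually_gt_at_top[of 0]
  proof eventually_elim
    case (elim m)
    have "(\<integral>\<^sup>+z. (if scale x z \<le> b / real m \<and> f z \<noteq> f x then 1 else 0) \<partial>M) = (\<integral>\<^sup>+z. 0 \<partial>M)"
      using elim(2) by (intro nn_integral_cong) auto
    then have far_0: "(\<integral>\<^sup>+z. (if scale x z \<le> b / real m \<and> f z \<noteq> f x then 1 else 0) \<partial>M) = 0"
      by simp
    have lam: "a * (a / real m) powr r * (a / real m) powr (- r) = a"
      using a elim(3) by (simp add: powr_minus)
    show ?case
      using elim(1) unfolding nn_integral_upper_fun[OF xs] far_0 lam by simp
  qed
qed

lemma lower_conditional: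
  assumes x: "good x"
  shows "eventually (\<lambda>m. ennreal (near_radius r / 4)
    \<le> (\<integral>\<^sup>+zs. lower_fun m (near_radius r / real m) ((1 / 8) / real m) x zs \<partial>PiM {..<m} (\<lambda>_. M))) sequentially"
proof -
  define a where "a = near_radius r"
  obtain u0 where u0: "radial_scale M (scale x) r u0"
    using good_scale[OF x] by blast
  have xs: "x \<in> space (Leb_d d)" "\<mu> x > 0"
    using x by (simp_all add: good_def)
  have a: "0 < a" "a \<le> 1 / 8"
    unfolding a_def using near_radius_bounds[OF r_gt_1] by auto
  have "a = (1 / (tail_const r * 8 powr r)) powr (1 / r)"
    by (simp add: a_def near_radius_def)
  from radial_scale.lower_estimate[OF u0 this] good_f_const_eventually[OF x, of a]
      eventually_gt_at_top[of 0]
  show ?thesis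
    unfolding a_def[symmetric]
  proof eventually_elim
    case (elim m)
    let ?s = "a / real m" and ?t = "(1 / 8) / real m"
    let ?h = "emeasure M {z \<in> space M. scale x z \<le> ?s}"
    let ?X = "of_nat m * (of_nat m * (?h * (\<integral>\<^sup>+z. (if scale x z \<le> ?t then 1 else 0)
        + ennreal (?s powr r * far_weight r ?t (scale x z)) \<partial>M)))"
    let ?L = "\<integral>\<^sup>+zs. lower_fun m ?s ?t x zs \<partial>PiM {..<m} (\<lambda>_. M)"
    have eq: "{z \<in> space M. scale x z \<le> ?s \<and> f z = f x} = {z \<in> space M. scale x z \<le> ?s}"
      using elim(2) by auto
    have "0 < ?s" "?s \<le> ?t"
      using a elim(3) by (auto intro!: divide_right_mono simp del: divide_divide_eq_left)
    from nn_integral_lower_fun[OF xs this, of m] have "of_nat m * ?h \<le> ?L + ?X"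
      unfolding eq .
    with elim(1) have le: "?X + ennreal (a / 4) \<le> ?X + ?L"
      by (simp only: add.commute[of _ ?X])
    \<comment> \<open>Cancelling \<open>?X\<close> in \<open>ennreal\<close> requires it to be
      finite, which follows from \<open>?X \<le> of_nat m * ?h\<close> and
      \<open>?h \<le> 1\<close>.\<close>
    have "?X \<le> of_nat m * ?h"
      using elim(1) by (rule order_trans[rotated]) simp
    also have "\<dots> < top"
    proof -
      have "?h \<le> 1"
        using emeasure_space[of M] total_mass by metis
      then have "?h < top"
        by (rule le_less_trans) simp
      then show ?thesis
        by (simp only: ennreal_mult_less_top of_nat_less_top simp_thms)
    qed
    finally have "?X \<noteq> top"
      by simp
    then show ?case
      using le by (simp add: ennreal_add_left_cancel_le)
  qed
qed

section \<open>Integration over the test point\<close>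

lemma upper_bound:
  assumes p: "0 < p" "p < 49 / 100"
  shows "limsup (\<lambda>m. exp_clean_error d \<beta> \<mu> f p m)
    \<le> ennreal (4 * (8 * tail_const r) powr (1 / (r - 1)) * 2 powr (r / (r - 1))
        * ln (1 / p) powr (r / (r - 1)) * p)"
proof -
  \<comment> \<open>Chosen so that exp (- (a / 2)) = p. Since p < 1/2, a is at least 2 ln 2 >
    1.\<close>
  define a where "a = 2 * ln (1 / p)"
  define b where "b = (8 * tail_const r) powr (1 / (r - 1)) * a powr (r / (r - 1))"
  have "2 \<le> 1 / p"
    using p by (simp add: field_simps)
  then have "ln 2 \<le> ln (1 / p)"
    using p by (subst ln_le_cancel_iff) auto
  then have a: "a \<ge> 1"
    using ln2_ge_two_thirds by (simp add: a_def)
  \<comment> \<open>The first fact orders the radii a/m and b/m; the second lets the terms of size p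
    be absorbed into p * b.\<close>
  have ab: "a \<le> b" and b: "b \<ge> 1"
  proof -
    have "1 * a powr 1 \<le> b"
      unfolding b_def using tail_const_ge[OF r_gt_1] r_gt_1 a
      by (intro mult_mono powr_mono ge_one_powr_ge_zero) (auto simp: field_simps)
    then show "a \<le> b" "b \<ge> 1"
      using a by auto
  qed
  \<comment> \<open>Capping at 1 provides a dominating function for the limsup form of Fatou's
    lemma. The default 1 is a valid bound where the estimate does not apply.\<close>
  define G where "G m zs = (if m > 0 \<and> \<mu> (zs m) > 0 then min 1
      (upper_fun p m (a / real m) (b / real m) (a * (a / real m) powr r) (zs m) zs) else 1)" for m zs
  define \<phi> where "\<phi> m x = (\<integral>\<^sup>+zs. G m (zs(m := x)) \<partial>PiM {..<m} (\<lambda>_. M))" for m x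
  have [measurable]: "(\<lambda>zs. upper_fun p m s t lam (zs m) zs) \<in> borel_measurable (PiM {..m} (\<lambda>_. M))" for m s t lam
    by (intro upper_fun_measurable sample_measurable) auto
  have [measurable]: "(\<lambda>zs. \<mu> (zs m)) \<in> borel_measurable (PiM {..m} (\<lambda>_. M))" for m :: nat
    by (intro measurable_compose[OF sample_measurable \<mu>_measurable]) auto
  have G [measurable]: "G m \<in> borel_measurable (PiM {..m} (\<lambda>_. M))" for m
    unfolding G_def by measurable
  have \<phi>_measurable: "\<phi> m \<in> borel_measurable M" for m
    unfolding \<phi>_def by (rule nn_integral_sample_test_point(2)[OF G])
  have err: "exp_clean_error d \<beta> \<mu> f p m \<le> (\<integral>\<^sup>+x. \<phi> m x \<partial>M)" for m
  proof -
    have "exp_clean_error d \<beta> \<mu> f p m \<le> (\<integral>\<^sup>+zs. G m zs \<partial>PiM {..m} (\<lambda>_. M))"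
      unfolding exp_clean_error_eq
    proof (rule nn_integral_mono)
      fix zs assume zs: "zs \<in> space (PiM {..m} (\<lambda>_. M))"
      have "cond_err p m zs \<le> 1"
        using p by (intro cond_err_le_one) auto
      moreover have "cond_err p m zs
          \<le> upper_fun p m (a / real m) (b / real m) (a * (a / real m) powr r) (zs m) zs"
        if "m > 0" "\<mu> (zs m) > 0"
        using that p a ab by (intro cond_err_le_upper_fun zs) (auto intro: divide_right_mono)
      ultimately show "cond_err p m zs \<le> G m zs"
        by (simp add: G_def)
    qed
    also have "\<dots> = (\<integral>\<^sup>+x. \<phi> m x \<partial>M)"
      unfolding \<phi>_def by (rule nn_integral_sample_test_point(1)[OF G])
    finally show ?thesis .
  qed
  have \<phi>_le_1: "\<phi> m x \<le> 1" for m x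
  proof -
    interpret S: prob_space "PiM {..<m} (\<lambda>_. M)"
      by (intro prob_space_PiM prob_space_M)
    have "\<phi> m x \<le> (\<integral>\<^sup>+zs. 1 \<partial>PiM {..<m} (\<lambda>_. M))"
      unfolding \<phi>_def by (intro nn_integral_mono) (simp add: G_def)
    then show ?thesis
      by (simp add: S.emeasure_space_1)
  qed
  have lim: "limsup (\<lambda>m. \<phi> m x) \<le> ennreal (2 * exp (- (a / 2)) + 2 * p * b)" if x: "good x" for x
  proof (rule Limsup_bounded)
    show "eventually (\<lambda>m. \<phi> m x \<le> ennreal (2 * exp (- (a / 2)) + 2 * p * b)) sequentially"
      using upper_conditional[OF x a less_imp_le[OF p(1)] b_def] eventually_gt_at_top[of 0]
    proof eventually_elim
      case (elim m)
      have "\<phi> m x \<le> (\<integral>\<^sup>+zs. upper_fun p m (a / real m) (b / real m) (a * (a / real m) powr r) x zs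
          \<partial>PiM {..<m} (\<lambda>_. M))"
        unfolding \<phi>_def using elim(2) x
        by (intro nn_integral_mono) (auto simp: G_def good_def upper_fun_def intro!: min.coboundedI2)
      then show ?case
        using elim(1) by (rule order_trans)
    qed
  qed
  have "limsup (\<lambda>m. exp_clean_error d \<beta> \<mu> f p m) \<le> limsup (\<lambda>m. \<integral>\<^sup>+x. \<phi> m x \<partial>M)"
    by (intro Limsup_mono always_eventually allI err)
  \<comment> \<open>Reverse Fatou, dominated by the constant 1 on a probability space.\<close>
  also have "\<dots> \<le> (\<integral>\<^sup>+x. limsup (\<lambda>m. \<phi> m x) \<partial>M)"
    by (rule nn_integral_limsup[where w = "\<lambda>_. 1"])
      (use \<phi>_measurable \<phi>_le_1 total_mass in auto)
  also have "\<dots> \<le> (\<integral>\<^sup>+x. ennreal (2 * exp (- (a / 2)) + 2 * p * b) \<partial>M)"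
    using AE_good by (intro nn_integral_mono_AE) (auto elim!: eventually_mono lim)
  also have "\<dots> = ennreal (2 * exp (- (a / 2)) + 2 * p * b)"
    using total_mass by simp
  also have "\<dots> \<le> ennreal (4 * b * p)"
  proof (rule ennreal_leI)
    have "exp (- (a / 2)) = p"
      using p by (simp add: a_def ln_div)
    moreover have "p \<le> p * b"
      using p b by simp
    ultimately show "2 * exp (- (a / 2)) + 2 * p * b \<le> 4 * b * p"
      by (simp add: algebra_simps)
  qed
  also have "4 * b * p = 4 * (8 * tail_const r) powr (1 / (r - 1)) * 2 powr (r / (r - 1))
        * ln (1 / p) powr (r / (r - 1)) * p"
    using p by (simp add: b_def a_def powr_mult)
  finally show ?thesis .
qed

lemma lower_bound:
  assumes p: "0 < p" "p < 1"
  shows "ennreal (near_radius r / 4 * p powr c_exp r) \<le> liminf (\<lambda>m. exp_clean_error d \<beta> \<mu> f p m)"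
proof -
  define a where "a = near_radius r"
  have a: "0 < a" "a \<le> 1 / 8"
    unfolding a_def using near_radius_bounds[OF r_gt_1] by auto
  \<comment> \<open>For a minorant the default value is 0.\<close>
  define G where "G m zs = (if m > 0 \<and> \<mu> (zs m) > 0 then ennreal p *
      lower_fun m (a / real m) ((1 / 8) / real m) (zs m) zs else 0)" for m zs
  define \<phi> where "\<phi> m x = (\<integral>\<^sup>+zs. G m (zs(m := x)) \<partial>PiM {..<m} (\<lambda>_. M))" for m x
  have [measurable]: "(\<lambda>zs. lower_fun m s t (zs m) zs) \<in> borel_measurable (PiM {..m} (\<lambda>_. M))" for m s t
    by (intro lower_fun_measurable sample_measurable) auto
  have [measurable]: "(\<lambda>zs. \<mu> (zs m)) \<in> borel_measurable (PiM {..m} (\<lambda>_. M))" for m :: nat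
    by (intro measurable_compose[OF sample_measurable \<mu>_measurable]) auto
  have G [measurable]: "G m \<in> borel_measurable (PiM {..m} (\<lambda>_. M))" for m
    unfolding G_def by measurable
  have \<phi>_measurable: "\<phi> m \<in> borel_measurable M" for m
    unfolding \<phi>_def by (rule nn_integral_sample_test_point(2)[OF G])
  have err: "(\<integral>\<^sup>+x. \<phi> m x \<partial>M) \<le> exp_clean_error d \<beta> \<mu> f p m" for m
  proof -
    have "(\<integral>\<^sup>+x. \<phi> m x \<partial>M) = (\<integral>\<^sup>+zs. G m zs \<partial>PiM {..m} (\<lambda>_. M))"
      unfolding \<phi>_def by (rule nn_integral_sample_test_point(1)[OF G, symmetric])
    also have "\<dots> \<le> exp_clean_error d \<beta> \<mu> f p m"
      unfolding exp_clean_error_eq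
    proof (rule nn_integral_mono)
      fix zs assume zs: "zs \<in> space (PiM {..m} (\<lambda>_. M))"
      show "G m zs \<le> cond_err p m zs"
      proof (cases "m > 0 \<and> \<mu> (zs m) > 0")
        case True
        then have "0 < a / real m" "a / real m \<le> (1 / 8) / real m"
          using a by (auto intro!: divide_right_mono simp del: divide_divide_eq_left)
        then have "ennreal p * lower_fun m (a / real m) ((1 / 8) / real m) (zs m) zs \<le> cond_err p m zs"
          using p True by (intro lower_fun_le_cond_err zs) auto
        then show ?thesis
          using True by (simp add: G_def)
      next
        case False
        then have "G m zs = 0"
          unfolding G_def by (rule if_not_P)
        then show ?thesis
          by simp
      qed
    qed
    finally show ?thesis .
  qed
  have lim: "ennreal (p * (a / 4)) \<le> liminf (\<lambda>m. \<phi> m x)" if x: "good x" for x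
  proof (rule Liminf_bounded)
    show "eventually (\<lambda>m. ennreal (p * (a / 4)) \<le> \<phi> m x) sequentially"
      using lower_conditional[OF x, folded a_def] eventually_gt_at_top[of 0]
    proof eventually_elim
      case (elim m)
      have [measurable]: "(\<lambda>zs. lower_fun m s t x zs) \<in> borel_measurable (PiM {..<m} (\<lambda>_. M))" for s t
        using x by (intro lower_fun_measurable sample_measurable) (auto simp: good_def)
      \<comment> \<open>\<open>lower_fun\<close> reads only the indices below m, so inserting the
        test point at m does not affect it.\<close>
      have "lower_fun m s t x (zs(m := x)) = lower_fun m s t x zs" for s t zs
      proof -
        have "(\<Sum>j\<in>{..<m} - {i}. far_weight r t (scale x ((zs(m := x)) j)))
            = (\<Sum>j\<in>{..<m} - {i}. far_weight r t (scale x (zs j)))" for i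
          by (intro sum.cong) auto
        then have "lone m s t x (zs(m := x)) i = lone m s t x zs i" if "i < m" for i
          using that by (auto simp: lone_def simp del: fun_upd_apply) (auto split: if_splits)
        then show ?thesis
          unfolding lower_fun_def by (intro sum.cong) auto
      qed
      then have "\<phi> m x = (\<integral>\<^sup>+zs. ennreal p * lower_fun m (a / real m) ((1 / 8) / real m) x zs \<partial>PiM {..<m} (\<lambda>_. M))"
        using x elim(2) by (simp add: \<phi>_def G_def good_def)
      also have "\<dots> = ennreal p * (\<integral>\<^sup>+zs. lower_fun m (a / real m) ((1 / 8) / real m) x zs \<partial>PiM {..<m} (\<lambda>_. M))"
        by (intro nn_integral_cmult) measurable
      also have "\<dots> \<ge> ennreal p * ennreal (a / 4)"
        by (intro mult_left_mono elim(1)) simp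
      finally show ?case
        using p a by (simp add: ennreal_mult[symmetric])
    qed
  qed
  have "p powr c_exp r \<le> p powr 1"
    using p c_exp_ge_1[OF r_gt_1] by (intro powr_mono') auto
  then have "a / 4 * p powr c_exp r \<le> p * (a / 4)"
    using p a by simp
  then have "ennreal (a / 4 * p powr c_exp r) \<le> ennreal (p * (a / 4))"
    by (rule ennreal_leI)
  also have "\<dots> = (\<integral>\<^sup>+x. ennreal (p * (a / 4)) \<partial>M)"
    using total_mass by simp
  also have "\<dots> \<le> (\<integral>\<^sup>+x. liminf (\<lambda>m. \<phi> m x) \<partial>M)"
    using AE_good by (intro nn_integral_mono_AE) (elim eventually_mono, rule lim)
  also have "\<dots> \<le> liminf (\<lambda>m. \<integral>\<^sup>+x. \<phi> m x \<partial>M)"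
    by (rule nn_integral_liminf[OF \<phi>_measurable])
  also have "\<dots> \<le> liminf (\<lambda>m. exp_clean_error d \<beta> \<mu> f p m)"
    by (intro Liminf_mono always_eventually allI err)
  finally show ?thesis
    by (simp add: a_def)
qed

end

theorem theorem3:
  shows "\<exists>C1 C2 :: real \<Rightarrow> real. (\<forall>r>1. C1 r > 0 \<and> C2 r > 0) \<and>
    (\<forall>(d::nat) (\<beta>::real) \<mu> f. d \<ge> 1 \<longrightarrow> \<beta> > real d \<longrightarrow> prob_density_d d \<mu> \<longrightarrow>
       (\<forall>x\<in>space (Leb_d d). f x \<in> {-1, 1}) \<longrightarrow>
       (AE x in Leb_d d. cont_at_d d \<mu> x) \<longrightarrow>
       (AE x in Leb_d d. locally_const_at_d d f x) \<longrightarrow>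
       (\<forall>p::real. 0 < p \<and> p < 49/100 \<longrightarrow>
          ennreal (C1 (\<beta> / real d) * p powr c_exp (\<beta> / real d))
            \<le> liminf (\<lambda>m. exp_clean_error d \<beta> \<mu> f p m) \<and>
          limsup (\<lambda>m. exp_clean_error d \<beta> \<mu> f p m)
            \<le> ennreal (C2 (\<beta> / real d) * ln (1 / p) powr (1 / (1 - real d / \<beta>)) * p)))"
proof (intro exI conjI allI impI)
  fix r :: real assume r: "r > 1"
  show "near_radius r / 4 > 0"
    using near_radius_bounds[OF r] by simp
  show "4 * (8 * tail_const r) powr (1 / (r - 1)) * 2 powr (r / (r - 1)) > 0"
    using tail_const_ge[OF r] by simp
next
  fix d :: nat and \<beta> :: real and \<mu> f :: "(nat \<Rightarrow> real) \<Rightarrow> real" and p :: real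
  assume "d \<ge> 1" "\<beta> > real d" "prob_density_d d \<mu>" "\<forall>x\<in>space (Leb_d d). f x \<in> {-1, 1}"
    "AE x in Leb_d d. cont_at_d d \<mu> x" "AE x in Leb_d d. locally_const_at_d d f x"
  then interpret NW_setup d \<beta> f \<mu>
    by unfold_locales
  assume p: "0 < p \<and> p < 49 / 100"
  show "ennreal (near_radius (\<beta> / real d) / 4 * p powr c_exp (\<beta> / real d))
      \<le> liminf (\<lambda>m. exp_clean_error d \<beta> \<mu> f p m)"
    using lower_bound[of p] p by (simp add: r_def)
  \<comment> \<open>Identifies the exponent produced by the choice of b with the one in the
    theorem.\<close>
  have "1 / (1 - real d / \<beta>) = r / (r - 1)"
    using d \<beta> by (simp add: r_def field_simps)
  then show "limsup (\<lambda>m. exp_clean_error d \<beta> \<mu> f p m)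
      \<le> ennreal (4 * (8 * tail_const (\<beta> / real d)) powr (1 / (\<beta> / real d - 1))
        * 2 powr (\<beta> / real d / (\<beta> / real d - 1))
        * ln (1 / p) powr (1 / (1 - real d / \<beta>)) * p)"
    using upper_bound[of p] p by (simp add: r_def)
qed

end
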